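(* Assume that $\lambda>0$ and $r>0$. Then $$\psi_\lambda\in\mathrm{dom}\left((r-A)^\alpha\right)\quad\text{for all }\alpha\in\left[0,\frac12+\frac\theta4\right).$$ In particular $D_\lambda\in\mathcal{L}\left(\mathbb{R};\mathrm{dom}((\lambda-A)^\alpha)\right)$ for all $\alpha\in\left[0,\frac12+\frac\theta4\right)$.
   Context: Fix $\theta\in(0,1)$ and let $\rho$ be one of the two weights $\rho(\xi)=\xi^{1+\theta}$ or $\rho(\xi)=\min(1,\xi^{1+\theta})$, $\xi\ge0$ (the result is for each of them). $\mathcal{H}=L^2((0,\infty);\rho(\xi)\,d\xi)$ with inner product $\langle\phi,\psi\rangle_{\mathcal{H}}=\int_0^\infty\phi(\xi)\psi(\xi)\rho(\xi)\,d\xi$. The Dirichlet heat semigroup on $L^2(0,\infty)$, $(T(t)f)(\xi)=\int_0^\infty k(t,\xi,\eta)f(\eta)\,d\eta$ with $k(t,\xi,\eta)=\frac{1}{\sqrt{4\pi t}}\left(e^{-(\xi-\eta)^2/(4t)}-e^{-(\xi+\eta)^2/(4t)}\right)$, extends (from $L^2(0,\infty)\cap\mathcal{H}$) to a bounded analytic $C_0$-semigroup $(e^{tA})_{t\ge0}$ on $\mathcal{H}$, whose generator is denoted $A$. For $\lambda>0$, $\psi_\lambda(\xi)=e^{-\sqrt\lambda\,\xi}$ for $\xi\ge 0$, and the Dirichlet map is $D_\lambda:\mathbb{R}\to\mathcal{H}$, $D_\lambda(a)=a\psi_\lambda$ (i.e. $\phi=D_\lambda(a)$ solves $(\lambda-\partial_\xi^2)\phi=0$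 on $(0,\infty)$, $\phi(0)=a$). Domains of fractional powers carry the graph norm. *)

theory Defs
  imports "HOL-Analysis.Analysis"
begin

(* Elements of L^2(M) are represented by square-integrable functions; all identities between
   elements of L^2(M) are identities almost everywhere. *)

definition L2 :: "'a measure \<Rightarrow> ('a \<Rightarrow> real) set" where
  "L2 M = {f \<in> borel_measurable M. integrable M (\<lambda>x. (f x)\<^sup>2)}"

definition L2_inner :: "'a measure \<Rightarrow> ('a \<Rightarrow> real) \<Rightarrow> ('a \<Rightarrow> real) \<Rightarrow> real" where
  "L2_inner M f g = (LINT x|M. f x * g x)"

definition L2_norm :: "'a measure \<Rightarrow> ('a \<Rightarrow> real) \<Rightarrow> real" where
  "L2_norm M f = sqrt (L2_inner M f f)"

definition L2_bounded_linear :: "'a measure \<Rightarrow> (('a \<Rightarrow> real) \<Rightarrow> ('a \<Rightarrow> real)) \<Rightarrow> bool" where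
  "L2_bounded_linear M T \<longleftrightarrow>
     (\<forall>f\<in>L2 M. T f \<in> L2 M) \<and>
     (\<forall>f\<in>L2 M. \<forall>g\<in>L2 M. \<forall>a b. AE x in M. T (\<lambda>y. a * f y + b * g y) x = a * T f x + b * T g x) \<and>
     (\<exists>K. \<forall>f\<in>L2 M. L2_norm M (T f) \<le> K * L2_norm M f)"

definition C0_semigroup :: "'a measure \<Rightarrow> (real \<Rightarrow> ('a \<Rightarrow> real) \<Rightarrow> ('a \<Rightarrow> real)) \<Rightarrow> bool" where
  "C0_semigroup M S \<longleftrightarrow>
     (\<forall>t\<ge>0. L2_bounded_linear M (S t)) \<and>
     (\<forall>f\<in>L2 M. AE x in M. S 0 f x = f x) \<and>
     (\<forall>s\<ge>0. \<forall>t\<ge>0. \<forall>f\<in>L2 M. AE x in M. S (s + t) f x = S s (S t f) x) \<and>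
     (\<forall>f\<in>L2 M. ((\<lambda>t. L2_norm M (\<lambda>x. S t f x - f x)) \<longlongrightarrow> 0) (at_right 0))"

definition bounded_semigroup :: "'a measure \<Rightarrow> (real \<Rightarrow> ('a \<Rightarrow> real) \<Rightarrow> ('a \<Rightarrow> real)) \<Rightarrow> bool" where
  "bounded_semigroup M S \<longleftrightarrow>
     (\<exists>K. \<forall>t\<ge>0. \<forall>f\<in>L2 M. L2_norm M (S t f) \<le> K * L2_norm M f)"

definition exp_stable :: "'a measure \<Rightarrow> (real \<Rightarrow> ('a \<Rightarrow> real) \<Rightarrow> ('a \<Rightarrow> real)) \<Rightarrow> bool" where
  "exp_stable M S \<longleftrightarrow>
     (\<exists>K. \<exists>\<delta>>0. \<forall>t\<ge>0. \<forall>f\<in>L2 M. L2_norm M (S t f) \<le> K * exp (- \<delta> * t) * L2_norm M f)"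

(* Unbounded operators are given by their graphs, closed under almost-everywhere equality in
   both components; the domain of an operator is the Domain of this relation. *)

type_synonym 'a operator = "(('a \<Rightarrow> real) \<times> ('a \<Rightarrow> real)) set"

definition generator :: "'a measure \<Rightarrow> (real \<Rightarrow> ('a \<Rightarrow> real) \<Rightarrow> ('a \<Rightarrow> real)) \<Rightarrow> 'a operator" where
  "generator M S = {(f, g). f \<in> L2 M \<and> g \<in> L2 M \<and>
     ((\<lambda>h. L2_norm M (\<lambda>x. (S h f x - f x) / h - g x)) \<longlongrightarrow> 0) (at_right 0)}"

definition op_neg :: "'a operator \<Rightarrow> 'a operator" where
  "op_neg B = {(f, \<lambda>x. - g x) | f g. (f, g) \<in> B}"

(* the operator r - A, on the domain of A *)
definition shifted :: "real \<Rightarrow> 'a operator \<Rightarrow> 'a operator" where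
  "shifted r A = {(f, \<lambda>x. r * f x - g x) | f g. (f, g) \<in> A}"

(* I is the Bochner integral of F over (0, \<infinity>) with values in L^2(M).  For the separable
   spaces used here, weak measurability together with integrability of the norm is Bochner
   integrability (Pettis), and the integral is determined by testing against L^2(M). *)
definition L2_has_integral :: "'a measure \<Rightarrow> (real \<Rightarrow> 'a \<Rightarrow> real) \<Rightarrow> ('a \<Rightarrow> real) \<Rightarrow> bool" where
  "L2_has_integral M F I \<longleftrightarrow>
     I \<in> L2 M \<and> (\<forall>t>0. F t \<in> L2 M) \<and>
     set_integrable lborel {0<..} (\<lambda>t. L2_norm M (F t)) \<and>
     (\<forall>w\<in>L2 M. set_integrable lborel {0<..} (\<lambda>t. L2_inner M (F t) w) \<and>
        (LINT t:{0<..}|lborel. L2_inner M (F t) w) = L2_inner M I w)"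

(* The power B^\<alpha>, \<alpha> \<ge> 0, of an operator B such that -B generates an exponentially stable
   C_0-semigroup U(t) = e^{-tB}: B^0 is the identity, and for \<alpha> > 0 the operator B^\<alpha> is the
   inverse of
     B^{-\<alpha>} g = 1/Gamma(\<alpha>) * integral over (0, \<infinity>) of t^(\<alpha>-1) U(t) g dt,
   so that dom(B^\<alpha>) is the range of B^{-\<alpha>}.  U is determined by its generator up to
   almost-everywhere equality. *)
definition frac_power :: "'a measure \<Rightarrow> 'a operator \<Rightarrow> real \<Rightarrow> 'a operator" where
  "frac_power M B \<alpha> = {(f, g). f \<in> L2 M \<and> g \<in> L2 M \<and>
     (if \<alpha> = 0 then (AE x in M. f x = g x)
      else \<exists>U. C0_semigroup M U \<and> exp_stable M U \<and> generator M U = op_neg B \<and>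
             L2_has_integral M (\<lambda>t x. t powr (\<alpha> - 1) / Gamma \<alpha> * U t g x) f)}"

(* An operator B is single-valued up to almost-everywhere equality, so for f in its domain the
   infimum is over a one-element set and equals norm f + norm (B f). *)
definition graph_norm :: "'a measure \<Rightarrow> 'a operator \<Rightarrow> ('a \<Rightarrow> real) \<Rightarrow> real" where
  "graph_norm M B f = (INF g\<in>{g. (f, g) \<in> B}. L2_norm M f + L2_norm M g)"

(* D is a bounded linear map from the reals into dom(B) with the graph norm *)
definition bounded_linear_into_dom ::
  "'a measure \<Rightarrow> 'a operator \<Rightarrow> (real \<Rightarrow> 'a \<Rightarrow> real) \<Rightarrow> bool" where
  "bounded_linear_into_dom M B D \<longleftrightarrow>
     (\<forall>a. D a \<in> Domain B) \<and>
     (\<forall>a b c d. AE x in M. D (c * a + d * b) x = c * D a x + d * D b x) \<and>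
     (\<exists>K. \<forall>a. graph_norm M B (D a) \<le> K * \<bar>a\<bar>)"

definition half_line :: "real measure" where
  "half_line = restrict_space lborel {0<..}"

(* L2 (weighted \<rho>) is the space H = L^2((0, \<infinity>); \<rho>(\<xi>) d\<xi>) *)
definition weighted :: "(real \<Rightarrow> real) \<Rightarrow> real measure" where
  "weighted \<rho> = density half_line (\<lambda>\<xi>. ennreal (\<rho> \<xi>))"

definition heat_kernel :: "real \<Rightarrow> real \<Rightarrow> real \<Rightarrow> real" where
  "heat_kernel t \<xi> \<eta> =
     1 / sqrt (4 * pi * t) * (exp (- (\<xi> - \<eta>)\<^sup>2 / (4 * t)) - exp (- (\<xi> + \<eta>)\<^sup>2 / (4 * t)))"

definition dirichlet_heat :: "real \<Rightarrow> (real \<Rightarrow> real) \<Rightarrow> real \<Rightarrow> real" where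
  "dirichlet_heat t f \<xi> = (LINT \<eta>|half_line. heat_kernel t \<xi> \<eta> * f \<eta>)"

(* S is the semigroup e^{tA}: since the intersection of L^2(0, \<infinity>) and H is dense in H, S is
   determined up to almost-everywhere equality. *)
definition dirichlet_heat_extension ::
  "(real \<Rightarrow> real) \<Rightarrow> (real \<Rightarrow> (real \<Rightarrow> real) \<Rightarrow> (real \<Rightarrow> real)) \<Rightarrow> bool" where
  "dirichlet_heat_extension \<rho> S \<longleftrightarrow>
     C0_semigroup (weighted \<rho>) S \<and> bounded_semigroup (weighted \<rho>) S \<and>
     (\<forall>t>0. \<forall>f \<in> L2 half_line \<inter> L2 (weighted \<rho>).
        AE \<xi> in weighted \<rho>. S t f \<xi> = dirichlet_heat t f \<xi>)"

definition psi :: "real \<Rightarrow> real \<Rightarrow> real" where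
  "psi l \<xi> = exp (- sqrt l * \<xi>)"

definition dirichlet_map :: "real \<Rightarrow> real \<Rightarrow> real \<Rightarrow> real" where
  "dirichlet_map l a = (\<lambda>\<xi>. a * psi l \<xi>)"

end

theory Submission
  imports Defs "HOL-Probability.Probability"
begin

text \<open>
  Write \<open>w\<^sub>u\<close> for the inward normal derivative at \<open>0\<close> of the Dirichlet heat kernel at time \<open>u\<close>, up to
  sign the heat flow \<open>e^(uA)\<close> of the derivative of a point mass at \<open>0\<close>. Three explicit facts carry the proof.

  \<^item> The heat flow shifts time: \<open>e^(tA) w\<^sub>u = w\<^sub>t\<^sub>+\<^sub>u\<close>.
  \<^item> The Laplace transform of \<open>u \<mapsto> w\<^sub>u\<close> at \<open>l\<close> is \<open>psi l\<close>.
  \<^item> In the weighted space the norm of \<open>w\<^sub>u\<close> is at most \<open>2 * u powr (\<theta>/4 - 1/2)\<close>.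

  For a measure \<open>\<mu>\<close> on the positive half line let \<open>g\<^sub>\<mu>\<close> be the average of the functions \<open>w\<^sub>u\<close> with respect
  to \<open>\<mu>\<close>. By Minkowski's integral inequality it lies in the weighted space as soon as \<open>\<mu>\<close> integrates
  \<open>u powr (\<theta>/4 - 1/2)\<close>. The negative power \<open>- a\<close> of \<open>r - A\<close> is the integral of \<open>e^(tA)\<close> against the
  gamma measure with density \<open>t powr (a - 1) * exp (- r * t) / Gamma a\<close>; as \<open>e^(tA)\<close> shifts time, it
  maps \<open>g\<^sub>\<mu>\<close> to the average over the convolution of this gamma measure with \<open>\<mu>\<close>
  (lemma \<open>gamma_average_boundary_average\<close>).

  It remains to write \<open>psi l\<close> as such an average. For \<open>l = r\<close> it is the average over the gamma measure
  with exponent \<open>1\<close>, that is, with density \<open>exp (- r * t)\<close>, which is the convolution of the gamma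
  measures with exponents \<open>a\<close> and \<open>1 - a\<close>. Hence \<open>psi r\<close> is the image of \<open>g\<^sub>\<mu>\<close>, where \<open>\<mu>\<close> has density of order \<open>u powr (- a)\<close>
  near \<open>0\<close>, and the integral of \<open>u powr (\<theta>/4 - 1/2 - a)\<close> converges at \<open>0\<close> exactly if
  \<open>a < 1/2 + \<theta>/4\<close>. For \<open>l \<noteq> r\<close> the difference \<open>psi l - psi r\<close> is \<open>r - l\<close> times the average over the
  convolution of two exponential measures (lemma \<open>psi_difference_eq_boundary_average\<close>), which
  contains the same gamma factor (lemma \<open>psi_preimage_frac_power\<close>).

  The extended semigroup is known explicitly only on functions that are also square-integrable
  without the weight, which the averages \<open>g\<^sub>\<mu>\<close> in question need not be; a truncation of \<open>\<mu>\<close> near \<open>0\<close>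
  bridges this (lemma \<open>extension_boundary_average\<close>).
\<close>

section \<open>Square-integrable functions\<close>

lemma L2_I: "f \<in> borel_measurable M \<Longrightarrow> integrable M (\<lambda>x. (f x)\<^sup>2) \<Longrightarrow> f \<in> L2 M"
  by (simp add: L2_def)

lemma L2_measurable [measurable_dest]: "f \<in> L2 M \<Longrightarrow> f \<in> borel_measurable M"
  by (simp add: L2_def)

lemma L2_square_integrable: "f \<in> L2 M \<Longrightarrow> integrable M (\<lambda>x. (f x)\<^sup>2)"
  by (simp add: L2_def)

lemma L2_mult_integrable:
  assumes "f \<in> L2 M" "g \<in> L2 M"
  shows "integrable M (\<lambda>x. f x * g x)"
proof (rule Bochner_Integration.integrable_bound)
  show "integrable M (\<lambda>x. (f x)\<^sup>2 + (g x)\<^sup>2)"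
    using assms by (simp add: L2_square_integrable)
  show "(\<lambda>x. f x * g x) \<in> borel_measurable M"
    using assms[THEN L2_measurable] by measurable
  have "\<bar>a * b\<bar> \<le> a\<^sup>2 + b\<^sup>2" for a b :: real
    using sum_squares_bound[of "\<bar>a\<bar>" "\<bar>b\<bar>"] abs_ge_zero[of "a * b"] unfolding abs_mult power2_abs by linarith
  then show "AE x in M. norm (f x * g x) \<le> norm ((f x)\<^sup>2 + (g x)\<^sup>2)"
    by simp
qed

lemma L2_lincomb:
  assumes f: "f \<in> L2 M" and g: "g \<in> L2 M"
  shows "(\<lambda>x. a * f x + b * g x) \<in> L2 M"
proof (rule L2_I)
  show "(\<lambda>x. a * f x + b * g x) \<in> borel_measurable M"
    using assms[THEN L2_measurable] by measurable
  have "integrable M (\<lambda>x. a\<^sup>2 * (f x)\<^sup>2 + b\<^sup>2 * (g x)\<^sup>2 + (2 * a * b) * (f x * g x))"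
    using assms by (intro Bochner_Integration.integrable_add integrable_mult_right L2_square_integrable L2_mult_integrable)
  then show "integrable M (\<lambda>x. (a * f x + b * g x)\<^sup>2)"
    by (rule back_subst[of "integrable M"]) (simp add: fun_eq_iff power2_eq_square algebra_simps)
qed

lemma L2_scale: "f \<in> L2 M \<Longrightarrow> (\<lambda>x. a * f x) \<in> L2 M"
  using L2_lincomb[of f M f a 0] by simp

lemma L2_add: "f \<in> L2 M \<Longrightarrow> g \<in> L2 M \<Longrightarrow> (\<lambda>x. f x + g x) \<in> L2 M"
  using L2_lincomb[of f M g 1 1] by simp

lemma L2_diff: "f \<in> L2 M \<Longrightarrow> g \<in> L2 M \<Longrightarrow> (\<lambda>x. f x - g x) \<in> L2 M"
  using L2_lincomb[of f M g 1 "-1"] by simp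

lemma L2_cong_AE:
  assumes "f \<in> L2 M" "g \<in> borel_measurable M" "AE x in M. f x = g x"
  shows "g \<in> L2 M"
proof (rule L2_I)
  note [measurable] = assms(1)[THEN L2_measurable] assms(2)
  show "integrable M (\<lambda>x. (g x)\<^sup>2)"
    using L2_square_integrable[OF assms(1)]
    by (rule integrable_cong_AE_imp) (use assms(3) in auto)
qed (fact assms)

lemma L2_inner_cong_AE:
  assumes "f \<in> L2 M" "f' \<in> L2 M" "g \<in> L2 M" "g' \<in> L2 M"
    and "AE x in M. f x = f' x" "AE x in M. g x = g' x"
  shows "L2_inner M f g = L2_inner M f' g'"
proof -
  note [measurable] = assms(1-4)[THEN L2_measurable]
  show ?thesis
    unfolding L2_inner_def using assms(5,6) by (intro integral_cong_AE) auto
qed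

lemma L2_norm_cong_AE:
  assumes "f \<in> L2 M" "g \<in> L2 M" "AE x in M. f x = g x"
  shows "L2_norm M f = L2_norm M g"
  unfolding L2_norm_def using assms by (simp add: L2_inner_cong_AE[of f M g f g])

lemma L2_inner_self: "L2_inner M f f = (LINT x|M. (f x)\<^sup>2)"
  by (simp add: L2_inner_def power2_eq_square)

lemma L2_inner_self_nonneg: "0 \<le> L2_inner M f f"
  by (simp add: L2_inner_self)

lemma L2_norm_nonneg [simp]: "0 \<le> L2_norm M f"
  by (simp add: L2_norm_def L2_inner_self_nonneg)

lemma L2_norm_square: "(L2_norm M f)\<^sup>2 = L2_inner M f f"
  by (simp add: L2_norm_def L2_inner_self_nonneg)

lemma L2_inner_commute: "L2_inner M f g = L2_inner M g f"
  by (simp add: L2_inner_def mult.commute)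

lemma L2_inner_lincomb:
  assumes "f \<in> L2 M" "g \<in> L2 M" "v \<in> L2 M"
  shows "L2_inner M (\<lambda>x. a * f x + b * g x) v = a * L2_inner M f v + b * L2_inner M g v"
proof -
  have "L2_inner M (\<lambda>x. a * f x + b * g x) v = (LINT x|M. a * (f x * v x) + b * (g x * v x))"
    by (simp add: L2_inner_def algebra_simps)
  also have "\<dots> = a * L2_inner M f v + b * L2_inner M g v"
    using assms by (simp add: L2_inner_def L2_mult_integrable)
  finally show ?thesis .
qed

lemma L2_inner_scale: "L2_inner M (\<lambda>x. a * f x) v = a * L2_inner M f v"
  by (simp add: L2_inner_def mult.assoc)

lemma L2_inner_diff:
  assumes "f \<in> L2 M" "g \<in> L2 M" "v \<in> L2 M"
  shows "L2_inner M (\<lambda>x. f x - g x) v = L2_inner M f v - L2_inner M g v"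
  using L2_inner_lincomb[OF assms, of 1 "-1"] by simp

lemma L2_norm_scale: "L2_norm M (\<lambda>x. a * f x) = \<bar>a\<bar> * L2_norm M f"
  unfolding L2_norm_def L2_inner_scale L2_inner_commute[of M f "\<lambda>x. a * f x"]
  by (simp add: real_sqrt_mult)

lemma L2_Cauchy_Schwarz:
  assumes f: "f \<in> L2 M" and g: "g \<in> L2 M"
  shows "\<bar>L2_inner M f g\<bar> \<le> L2_norm M f * L2_norm M g"
proof -
  define F G I where "F = L2_inner M f f" and "G = L2_inner M g g" and "I = L2_inner M f g"
  have "I\<^sup>2 \<le> F * G"
  proof (cases "G = 0")
    case True
    then have "(LINT x|M. (g x)\<^sup>2) = 0"
      by (simp only: G_def L2_inner_self)
    then have "AE x in M. (g x)\<^sup>2 = 0"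
      using integral_nonneg_eq_0_iff_AE[OF L2_square_integrable[OF g]] by simp
    then have "AE x in M. f x * g x = 0"
      by eventually_elim simp
    then have "I = 0"
      unfolding I_def L2_inner_def by (rule integral_eq_zero_AE)
    then show ?thesis by (simp add: True)
  next
    case False
    let ?h = "\<lambda>x. G * f x + (- I) * g x"
    have "L2_inner M ?h ?h = G * L2_inner M f ?h + (- I) * L2_inner M g ?h"
      using f g by (intro L2_inner_lincomb L2_lincomb)
    also have "L2_inner M f ?h = G * F + (- I) * L2_inner M g f"
      unfolding F_def L2_inner_commute[of M f ?h] using f g by (intro L2_inner_lincomb)
    also have "L2_inner M g f = I"
      unfolding I_def by (rule L2_inner_commute)
    also have "L2_inner M g ?h = G * I + (- I) * G"
      unfolding L2_inner_commute[of M g ?h]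
      using L2_inner_lincomb[OF f g g, of G "- I"] by (simp only: I_def[symmetric] G_def[symmetric])
    finally have "0 \<le> G * (G * F - I * I)"
      using L2_inner_self_nonneg[of M ?h] by (simp add: algebra_simps)
    moreover have "0 < G"
      using False L2_inner_self_nonneg[of M g] by (simp add: G_def)
    ultimately show ?thesis
      by (simp add: zero_le_mult_iff power2_eq_square mult.commute)
  qed
  then have "sqrt (I\<^sup>2) \<le> sqrt (F * G)" by (rule real_sqrt_le_mono)
  then show ?thesis by (simp add: L2_norm_def F_def G_def I_def real_sqrt_mult)
qed

lemma L2_norm_triangle:
  assumes f: "f \<in> L2 M" and g: "g \<in> L2 M"
  shows "L2_norm M (\<lambda>x. f x + g x) \<le> L2_norm M f + L2_norm M g"
proof (rule power2_le_imp_le)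
  let ?h = "\<lambda>x. f x + g x"
  have h: "?h \<in> L2 M" using assms by (rule L2_add)
  have "(L2_norm M ?h)\<^sup>2 = L2_inner M f ?h + L2_inner M g ?h"
    using L2_inner_lincomb[OF f g h, of 1 1] by (simp add: L2_norm_square)
  also have "\<dots> = (L2_norm M f)\<^sup>2 + 2 * L2_inner M f g + (L2_norm M g)\<^sup>2"
    using L2_inner_lincomb[OF f g f, of 1 1] L2_inner_lincomb[OF f g g, of 1 1]
    by (simp add: L2_inner_commute[of M f ?h] L2_inner_commute[of M g ?h]
        L2_inner_commute[of M g f] L2_norm_square)
  also have "\<dots> \<le> (L2_norm M f)\<^sup>2 + 2 * (L2_norm M f * L2_norm M g) + (L2_norm M g)\<^sup>2"
    using L2_Cauchy_Schwarz[OF f g] by simp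
  finally show "(L2_norm M ?h)\<^sup>2 \<le> (L2_norm M f + L2_norm M g)\<^sup>2"
    by (simp add: power2_sum)
qed simp

lemma L2_norm_diff_abs:
  assumes f: "f \<in> L2 M" and g: "g \<in> L2 M"
  shows "\<bar>L2_norm M f - L2_norm M g\<bar> \<le> L2_norm M (\<lambda>x. f x - g x)"
proof -
  have "L2_norm M f \<le> L2_norm M g + L2_norm M (\<lambda>x. f x - g x)"
    using L2_norm_triangle[OF g L2_diff[OF f g]] by simp
  moreover have "L2_norm M g \<le> L2_norm M f + L2_norm M (\<lambda>x. f x - g x)"
    using L2_norm_triangle[OF f L2_scale[OF L2_diff[OF f g], of "-1"]]
      L2_norm_scale[of M "-1" "\<lambda>x. f x - g x"] by simp
  ultimately show ?thesis by linarith
qed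

section \<open>Averages of families in a space of square-integrable functions\<close>

text \<open>
  The Bochner integral of \<open>W u\<close> against \<open>\<mu>\<close> is represented by the pointwise integral. The bound
  \<open>n\<close> on the norms replaces the norms themselves because it is measurable and strictly positive,
  so that one may divide by it.
\<close>

locale L2_kernel_average = sigma_finite_measure M + \<mu>: finite_measure \<mu>
  for M :: "'a measure" and \<mu> :: "'b measure" +
  fixes W :: "'b \<Rightarrow> 'a \<Rightarrow> real" and n :: "'b \<Rightarrow> real"
  assumes W_measurable [measurable]: "(\<lambda>(u, x). W u x) \<in> borel_measurable (\<mu> \<Otimes>\<^sub>M M)"
    and n_integrable: "integrable \<mu> n"
    and n_pos: "AE u in \<mu>. 0 < n u"
    and W_L2: "AE u in \<mu>. W u \<in> L2 M"
    and W_norm: "AE u in \<mu>. L2_norm M (W u) \<le> n u"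
begin

lemma n_measurable [measurable]: "n \<in> borel_measurable \<mu>"
  using n_integrable by simp

interpretation pair_sigma_finite \<mu> M ..

abbreviation average :: "'a \<Rightarrow> real" where
  "average \<equiv> \<lambda>x. LINT u|\<mu>. W u x"

lemma average_measurable [measurable]: "average \<in> borel_measurable M"
  by measurable

text \<open>
  Minkowski's integral inequality. The Cauchy-Schwarz inequality applied to
  \<open>\<bar>W u x\<bar> = sqrt (n u) * (\<bar>W u x\<bar> / sqrt (n u))\<close> gives a pointwise bound which Tonelli's theorem
  integrates to \<open>(\<integral> n d\<mu>)\<^sup>2\<close>.
\<close>

lemma average_square_nn:
  "(\<integral>\<^sup>+x. ennreal ((average x)\<^sup>2) \<partial>M) \<le> ennreal ((LINT u|\<mu>. n u)\<^sup>2)"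
proof -
  define N where "N = (LINT u|\<mu>. n u)"
  have N: "(\<integral>\<^sup>+u. ennreal (n u) \<partial>\<mu>) = ennreal N"
    unfolding N_def using n_integrable n_pos by (intro nn_integral_eq_integral) auto
  have pointwise: "ennreal ((average x)\<^sup>2) \<le> ennreal N * (\<integral>\<^sup>+u. ennreal ((W u x)\<^sup>2 / n u) \<partial>\<mu>)"
    if [measurable]: "x \<in> space M" for x
  proof -
    have [measurable]: "(\<lambda>u. W u x) \<in> borel_measurable \<mu>"
      by measurable
    have "ennreal \<bar>average x\<bar> \<le> (\<integral>\<^sup>+u. ennreal \<bar>W u x\<bar> \<partial>\<mu>)"
      using integral_norm_bound_ennreal[of \<mu> "\<lambda>u. W u x"]
      by (cases "integrable \<mu> (\<lambda>u. W u x)") (auto simp: not_integrable_integral_eq)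
    also have "\<dots> = (\<integral>\<^sup>+u. ennreal (sqrt (n u)) * ennreal (\<bar>W u x\<bar> / sqrt (n u)) \<partial>\<mu>)"
      using n_pos by (intro nn_integral_cong_AE) (auto simp: ennreal_mult[symmetric])
    finally have "(ennreal \<bar>average x\<bar>)\<^sup>2 \<le>
        (\<integral>\<^sup>+u. ennreal (sqrt (n u)) * ennreal (\<bar>W u x\<bar> / sqrt (n u)) \<partial>\<mu>)\<^sup>2"
      by (rule power_mono) simp
    also have "\<dots> \<le> (\<integral>\<^sup>+u. (ennreal (sqrt (n u)))\<^sup>2 \<partial>\<mu>) * (\<integral>\<^sup>+u. (ennreal (\<bar>W u x\<bar> / sqrt (n u)))\<^sup>2 \<partial>\<mu>)"
      by (rule Cauchy_Schwarz_nn_integral) measurable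
    also have "(\<integral>\<^sup>+u. (ennreal (sqrt (n u)))\<^sup>2 \<partial>\<mu>) = (\<integral>\<^sup>+u. ennreal (n u) \<partial>\<mu>)"
      using n_pos by (intro nn_integral_cong_AE) (auto simp: ennreal_power)
    also have "(\<integral>\<^sup>+u. (ennreal (\<bar>W u x\<bar> / sqrt (n u)))\<^sup>2 \<partial>\<mu>) = (\<integral>\<^sup>+u. ennreal ((W u x)\<^sup>2 / n u) \<partial>\<mu>)"
      using n_pos by (intro nn_integral_cong_AE) (auto simp: ennreal_power power_divide)
    finally show ?thesis by (simp add: N ennreal_power)
  qed
  have "(\<integral>\<^sup>+x. ennreal ((average x)\<^sup>2) \<partial>M) \<le> (\<integral>\<^sup>+x. ennreal N * (\<integral>\<^sup>+u. ennreal ((W u x)\<^sup>2 / n u) \<partial>\<mu>) \<partial>M)"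
    by (intro nn_integral_mono pointwise)
  also have "\<dots> = ennreal N * (\<integral>\<^sup>+x. \<integral>\<^sup>+u. ennreal ((W u x)\<^sup>2 / n u) \<partial>\<mu> \<partial>M)"
    by (intro nn_integral_cmult) measurable
  also have "(\<integral>\<^sup>+x. \<integral>\<^sup>+u. ennreal ((W u x)\<^sup>2 / n u) \<partial>\<mu> \<partial>M) =
      (\<integral>\<^sup>+u. \<integral>\<^sup>+x. ennreal ((W u x)\<^sup>2 / n u) \<partial>M \<partial>\<mu>)"
    by (rule Fubini') measurable
  also have "\<dots> \<le> (\<integral>\<^sup>+u. ennreal (n u) \<partial>\<mu>)"
  proof (intro nn_integral_mono_AE)
    show "AE u in \<mu>. (\<integral>\<^sup>+x. ennreal ((W u x)\<^sup>2 / n u) \<partial>M) \<le> ennreal (n u)"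
      using n_pos W_L2 W_norm
    proof eventually_elim
      case (elim u)
      have "(\<integral>\<^sup>+x. ennreal ((W u x)\<^sup>2 / n u) \<partial>M) = ennreal (LINT x|M. (W u x)\<^sup>2 / n u)"
        using elim L2_square_integrable[of "W u" M] by (intro nn_integral_eq_integral) auto
      also have "(LINT x|M. (W u x)\<^sup>2 / n u) = (L2_norm M (W u))\<^sup>2 / n u"
        by (simp add: L2_norm_square L2_inner_self)
      also have "\<dots> \<le> (n u)\<^sup>2 / n u"
        using elim by (intro divide_right_mono power_mono) auto
      finally show ?case using elim by (simp add: power2_eq_square ennreal_leI)
    qed
  qed
  finally have "(\<integral>\<^sup>+x. ennreal ((average x)\<^sup>2) \<partial>M) \<le> ennreal N * ennreal N"
    by (simp add: N mult_left_mono)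
  moreover have "0 \<le> N"
    unfolding N_def using n_pos by (intro integral_nonneg_AE) auto
  ultimately show ?thesis
    by (simp add: N_def[symmetric] power2_eq_square ennreal_mult)
qed

lemma average_L2: "average \<in> L2 M"
proof (rule L2_I)
  show "integrable M (\<lambda>x. (average x)\<^sup>2)"
  proof (rule integrableI_nonneg)
    show "(\<integral>\<^sup>+x. ennreal ((average x)\<^sup>2) \<partial>M) < \<infinity>"
      using average_square_nn by (rule le_less_trans) simp
  qed auto
qed measurable

lemma n_mean_nonneg: "0 \<le> (LINT u|\<mu>. n u)"
  using n_pos by (intro integral_nonneg_AE) auto

lemma average_norm_le: "L2_norm M average \<le> (LINT u|\<mu>. n u)"
proof (rule power2_le_imp_le)
  have "ennreal (LINT x|M. (average x)\<^sup>2) \<le> ennreal ((LINT u|\<mu>. n u)\<^sup>2)"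
    using average_square_nn L2_square_integrable[OF average_L2]
    by (subst nn_integral_eq_integral[symmetric]) auto
  then show "(L2_norm M average)\<^sup>2 \<le> (LINT u|\<mu>. n u)\<^sup>2"
    by (simp add: L2_norm_square L2_inner_self)
qed (rule n_mean_nonneg)

lemma product_integrable:
  assumes v: "v \<in> L2 M"
  shows "integrable (\<mu> \<Otimes>\<^sub>M M) (\<lambda>(u, x). W u x * v x)"
proof (rule Fubini_integrable)
  have [measurable]: "v \<in> borel_measurable M" using v by (rule L2_measurable)
  show "(\<lambda>(u, x). W u x * v x) \<in> borel_measurable (\<mu> \<Otimes>\<^sub>M M)"
    by measurable
  have abs_L2: "(\<lambda>x. \<bar>f x\<bar>) \<in> L2 M" if "f \<in> L2 M" for f
    using that by (auto simp: L2_def)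
  have abs_norm: "L2_norm M (\<lambda>x. \<bar>f x\<bar>) = L2_norm M f" for f
    by (simp add: L2_norm_def L2_inner_self)
  show "integrable \<mu> (\<lambda>u. LINT x|M. norm (case (u, x) of (u, x) \<Rightarrow> W u x * v x))"
  proof (rule Bochner_Integration.integrable_bound)
    show "integrable \<mu> (\<lambda>u. n u * L2_norm M v)" using n_integrable by simp
    show "AE u in \<mu>. norm (LINT x|M. norm (case (u, x) of (u, x) \<Rightarrow> W u x * v x)) \<le> norm (n u * L2_norm M v)"
      using n_pos W_L2 W_norm
    proof eventually_elim
      case (elim u)
      have "\<bar>L2_inner M (\<lambda>x. \<bar>W u x\<bar>) (\<lambda>x. \<bar>v x\<bar>)\<bar> \<le> L2_norm M (W u) * L2_norm M v"
        using L2_Cauchy_Schwarz[OF abs_L2[OF elim(2)] abs_L2[OF v]] by (simp add: abs_norm)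
      also have "\<dots> \<le> n u * L2_norm M v"
        using elim by (intro mult_right_mono) auto
      finally show ?case using elim by (simp add: L2_inner_def abs_mult)
    qed
  qed measurable
  show "AE u in \<mu>. integrable M (\<lambda>x. case (u, x) of (u, x) \<Rightarrow> W u x * v x)"
    using W_L2 by eventually_elim (use v in \<open>simp add: L2_mult_integrable\<close>)
qed

lemma inner_integrable:
  assumes v: "v \<in> L2 M"
  shows "integrable \<mu> (\<lambda>u. L2_inner M (W u) v)"
  using integrable_fst'[OF product_integrable[OF v]] by (simp add: L2_inner_def)

text \<open>
  This is what identifies the pointwise integral with the weak, hence the Bochner, integral.
\<close>

lemma inner_average:
  assumes v: "v \<in> L2 M"
  shows "L2_inner M average v = (LINT u|\<mu>. L2_inner M (W u) v)"
proof -
  have "L2_inner M average v = (LINT x|M. (LINT u|\<mu>. W u x * v x))"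
    by (simp add: L2_inner_def)
  also have "\<dots> = (LINT u|\<mu>. (LINT x|M. W u x * v x))"
    using Fubini_integral[OF product_integrable[OF v]] by simp
  finally show ?thesis by (simp add: L2_inner_def)
qed

end

section \<open>The boundary kernel of the Dirichlet heat equation\<close>

text \<open>
  The inward normal derivative at the boundary point \<open>0\<close> of the Dirichlet heat kernel at time \<open>u\<close>;
  equivalently, the density in \<open>u\<close> of the first time at which a Brownian motion (with generator the
  second derivative) started at \<open>x\<close> hits \<open>0\<close>.
\<close>

definition boundary_kernel :: "real \<Rightarrow> real \<Rightarrow> real" where
  "boundary_kernel u x = x / (2 * sqrt pi * u powr (3/2)) * exp (- x\<^sup>2 / (4 * u))"

lemma boundary_kernel_measurable [measurable]:
  "(\<lambda>z. boundary_kernel (f z) (g z)) \<in> borel_measurable M"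
  if [measurable]: "f \<in> borel_measurable M" "g \<in> borel_measurable M"
  unfolding boundary_kernel_def by measurable

lemma boundary_kernel_nonneg: "0 \<le> x \<Longrightarrow> 0 \<le> boundary_kernel u x"
  by (simp add: boundary_kernel_def)

lemma space_half_line [simp]: "space half_line = {0<..}"
  by (simp add: half_line_def space_restrict_space)

lemma half_line_measurable: "f \<in> borel_measurable borel \<Longrightarrow> f \<in> borel_measurable half_line"
  unfolding half_line_def by (rule measurable_restrict_space1) simp

lemma sigma_finite_half_line: "sigma_finite_measure half_line"
  unfolding half_line_def by (rule sigma_finite_measure_restrict_space) (auto intro: lborel.sigma_finite_measure_axioms)

lemma space_weighted [simp]: "space (weighted \<rho>) = {0<..}"
  by (simp add: weighted_def)

lemma sets_weighted [measurable_cong]: "sets (weighted \<rho>) = sets half_line"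
  by (simp add: weighted_def)

lemma weighted_one: "weighted (\<lambda>_. 1) = half_line"
  by (simp add: weighted_def density_1)

lemma weighted_measurable: "f \<in> borel_measurable borel \<Longrightarrow> f \<in> borel_measurable (weighted \<rho>)"
  unfolding weighted_def by (simp add: half_line_measurable)

lemma sigma_finite_weighted:
  assumes [measurable]: "\<rho> \<in> borel_measurable borel"
  shows "sigma_finite_measure (weighted \<rho>)"
  unfolding weighted_def
  by (subst sigma_finite_measure.sigma_finite_iff_density_finite[OF sigma_finite_half_line])
     (auto intro!: half_line_measurable)

lemma nn_integral_weighted:
  assumes [measurable]: "\<rho> \<in> borel_measurable borel" "f \<in> borel_measurable borel"
  shows "(\<integral>\<^sup>+x. f x \<partial>weighted \<rho>) = (\<integral>\<^sup>+x. ennreal (\<rho> x) * f x * indicator {0<..} x \<partial>lborel)"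
proof -
  have "(\<integral>\<^sup>+x. f x \<partial>weighted \<rho>) = (\<integral>\<^sup>+x. ennreal (\<rho> x) * f x \<partial>half_line)"
    unfolding weighted_def by (intro nn_integral_density half_line_measurable) measurable
  also have "\<dots> = (\<integral>\<^sup>+x. ennreal (\<rho> x) * f x * indicator {0<..} x \<partial>lborel)"
    unfolding half_line_def by (intro nn_integral_restrict_space) auto
  finally show ?thesis .
qed

lemma nn_integral_Gaussian_first_moment:
  assumes "0 < u"
  shows "(\<integral>\<^sup>+x. ennreal (x * exp (- x\<^sup>2 / (4 * u))) * indicator {0..} x \<partial>lborel) = ennreal (2 * u)"
proof -
  have "(\<integral>\<^sup>+x. ennreal (x * exp (- x\<^sup>2 / (4 * u))) * indicator {0..} x \<partial>lborel) =
      0 - (- 2 * u * exp (- 0\<^sup>2 / (4 * u)))"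
  proof (rule nn_integral_FTC_atLeast)
    show "DERIV (\<lambda>x. - 2 * u * exp (- x\<^sup>2 / (4 * u))) x :> x * exp (- x\<^sup>2 / (4 * u))" for x
      using assms by (auto intro!: derivative_eq_intros simp: field_simps)
    show "((\<lambda>x. - 2 * u * exp (- x\<^sup>2 / (4 * u))) \<longlongrightarrow> 0) at_top"
      using assms by real_asymp
  qed auto
  then show ?thesis by simp
qed

lemma powr_le_exp:
  fixes y p :: real
  assumes "0 < y" "0 \<le> p" "p \<le> 2"
  shows "y powr p \<le> 2 * exp y"
proof -
  have "y powr p \<le> 1 + y\<^sup>2"
  proof (cases "y \<le> 1")
    case True
    then have "y powr p \<le> 1" using assms by (simp add: powr_le1)
    then show ?thesis by (simp add: add_increasing2)
  next
    case False
    then have "y powr p \<le> y powr 2" using assms by (intro powr_mono) auto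
    then show ?thesis using assms by (simp add: powr_numeral)
  qed
  also have "\<dots> \<le> 2 * exp y"
    using exp_lower_Taylor_quadratic[of y] assms by (simp add: field_simps)
  finally show ?thesis .
qed

lemma boundary_kernel_square_le:
  assumes u: "0 < u" and x: "0 < x" and q: "-1 \<le> q" "q \<le> 1"
  shows "(boundary_kernel u x)\<^sup>2 * x powr (1 + q) \<le> 2 * u powr (q/2 - 2) * (x * exp (- x\<^sup>2 / (4 * u)))"
proof -
  \<comment> \<open>One factor \<open>exp (- y)\<close> absorbs \<open>x powr (2 + q)\<close>; the other one keeps the integral over \<open>x\<close> finite.\<close>
  define y where "y = x\<^sup>2 / (4 * u)"
  have y: "0 < y" using u x by (simp add: y_def)
  have "x powr (2 + q) = (x powr 2) powr (1 + q/2)"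
    by (simp add: powr_powr algebra_simps)
  also have "x powr 2 = 4 * (u * y)"
    using u x by (simp add: y_def powr_numeral)
  also have "(4 * (u * y)) powr (1 + q/2) = 4 powr (1 + q/2) * u powr (1 + q/2) * y powr (1 + q/2)"
    using u y by (simp add: powr_mult)
  also have "\<dots> \<le> 8 * u powr (1 + q/2) * (2 * exp y)"
  proof (intro mult_mono)
    have "(4::real) powr (1 + q/2) \<le> 4 powr (3/2)"
      using q by (intro powr_mono) auto
    also have "(4::real) powr (3/2) = (4 powr (1/2)) * 4"
      using powr_add[of "4::real" "1/2" 1] by simp
    also have "\<dots> = 8" by (simp add: powr_half_sqrt)
    finally show "(4::real) powr (1 + q/2) \<le> 8" .
    show "y powr (1 + q/2) \<le> 2 * exp y" using y q by (intro powr_le_exp) auto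
  qed auto
  finally have *: "x powr (2 + q) \<le> 16 * u powr (1 + q/2) * exp y" by simp
  have "(boundary_kernel u x)\<^sup>2 = x\<^sup>2 / (4 * pi * u powr 3) * (exp (- y))\<^sup>2"
    using u by (simp add: boundary_kernel_def y_def power_mult_distrib power_divide powr_powr
        flip: powr_realpow'  powr_numeral)
      (simp add: power2_eq_square flip: powr_add)
  also have "\<dots> = x\<^sup>2 / (4 * pi * u powr 3) * (exp (- y) * exp (- y))"
    by (simp add: power2_eq_square)
  finally have "(boundary_kernel u x)\<^sup>2 * x powr (1 + q) =
      x * exp (- y) / (4 * pi * u powr 3) * (x powr (2 + q) * exp (- y))"
    using x by (simp add: powr_add power2_eq_square)
  also have "\<dots> \<le> x * exp (- y) / (4 * pi * u powr 3) * (16 * u powr (1 + q/2) * exp y * exp (- y))"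
    using * x by (intro mult_left_mono mult_right_mono) auto
  also have "\<dots> = 4 / pi * (u powr (1 + q/2) / u powr 3) * (x * exp (- y))"
    by (simp add: exp_minus field_simps)
  also have "u powr (1 + q/2) / u powr 3 = u powr (q/2 - 2)"
    by (simp flip: powr_diff)
  also have "4 / pi * u powr (q/2 - 2) * (x * exp (- y)) \<le> 2 * u powr (q/2 - 2) * (x * exp (- y))"
    using x pi_ge_two by (intro mult_right_mono) (auto simp: field_simps)
  finally show ?thesis by (simp add: y_def)
qed

text \<open>
  The blow-up rate of the kernel as \<open>u\<close> tends to \<open>0\<close>, obtained by integrating the preceding bound.
  With \<open>q = \<theta>\<close> it is the rate in the weighted space, with \<open>q = -1\<close> the rate \<open>u powr (-3/4)\<close> in
  the unweighted one.
\<close>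

lemma boundary_kernel_L2:
  assumes u: "0 < u" and q: "-1 \<le> q" "q \<le> 1"
    and \<rho> [measurable]: "\<rho> \<in> borel_measurable borel"
    and \<rho>_le: "\<And>x. 0 < x \<Longrightarrow> 0 \<le> \<rho> x \<and> \<rho> x \<le> x powr (1 + q)"
  shows "boundary_kernel u \<in> L2 (weighted \<rho>)"
    and "L2_norm (weighted \<rho>) (boundary_kernel u) \<le> 2 * u powr (q/4 - 1/2)"
proof -
  have [measurable]: "boundary_kernel u \<in> borel_measurable (weighted \<rho>)"
    by (rule weighted_measurable) measurable
  have "(\<integral>\<^sup>+x. ennreal ((boundary_kernel u x)\<^sup>2) \<partial>weighted \<rho>) =
      (\<integral>\<^sup>+x. ennreal (\<rho> x) * ennreal ((boundary_kernel u x)\<^sup>2) * indicator {0<..} x \<partial>lborel)"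
    by (intro nn_integral_weighted) measurable
  also have "\<dots> \<le> (\<integral>\<^sup>+x. ennreal (2 * u powr (q/2 - 2)) *
      (ennreal (x * exp (- x\<^sup>2 / (4 * u))) * indicator {0..} x) \<partial>lborel)"
  proof (intro nn_integral_mono)
    fix x :: real
    show "ennreal (\<rho> x) * ennreal ((boundary_kernel u x)\<^sup>2) * indicator {0<..} x \<le>
      ennreal (2 * u powr (q/2 - 2)) * (ennreal (x * exp (- x\<^sup>2 / (4 * u))) * indicator {0..} x)"
    proof (cases "0 < x")
      case True
      have "\<rho> x * (boundary_kernel u x)\<^sup>2 \<le> x powr (1 + q) * (boundary_kernel u x)\<^sup>2"
        using \<rho>_le[OF True] by (intro mult_right_mono) auto
      also have "\<dots> \<le> 2 * u powr (q/2 - 2) * (x * exp (- x\<^sup>2 / (4 * u)))"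
        using boundary_kernel_square_le[OF u True q] by (simp add: mult.commute)
      finally show ?thesis
        using True \<rho>_le[OF True] by (simp add: ennreal_mult[symmetric] ennreal_leI)
    qed simp
  qed
  also have "\<dots> = ennreal (2 * u powr (q/2 - 2)) * ennreal (2 * u)"
    using nn_integral_Gaussian_first_moment[OF u] by (subst nn_integral_cmult) simp_all
  also have "\<dots> = ennreal (4 * (u powr (q/2 - 2) * u powr 1))"
    using u by (simp add: ennreal_mult[symmetric] mult.assoc)
  also have "u powr (q/2 - 2) * u powr 1 = u powr (q/2 - 1)"
    unfolding powr_add[symmetric] by simp
  finally have le: "(\<integral>\<^sup>+x. ennreal ((boundary_kernel u x)\<^sup>2) \<partial>weighted \<rho>) \<le> ennreal (4 * u powr (q/2 - 1))" .
  show mem: "boundary_kernel u \<in> L2 (weighted \<rho>)"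
  proof (rule L2_I)
    show "integrable (weighted \<rho>) (\<lambda>x. (boundary_kernel u x)\<^sup>2)"
      using le by (intro integrableI_nonneg) (auto intro: le_less_trans)
  qed measurable
  have "ennreal (LINT x|weighted \<rho>. (boundary_kernel u x)\<^sup>2) \<le> ennreal (4 * u powr (q/2 - 1))"
    using le L2_square_integrable[OF mem] by (subst nn_integral_eq_integral[symmetric]) auto
  then have "(LINT x|weighted \<rho>. (boundary_kernel u x)\<^sup>2) \<le> 4 * u powr (q/2 - 1)"
    by (simp add: ennreal_le_iff)
  also have "u powr (q/2 - 1) = u powr (q/4 - 1/2) * u powr (q/4 - 1/2)"
    by (simp flip: powr_add)
  finally have "(L2_norm (weighted \<rho>) (boundary_kernel u))\<^sup>2 \<le> (2 * u powr (q/4 - 1/2))\<^sup>2"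
    by (simp add: L2_norm_square L2_inner_self power_mult_distrib)
       (simp add: power2_eq_square[of "u powr _"])
  then show "L2_norm (weighted \<rho>) (boundary_kernel u) \<le> 2 * u powr (q/4 - 1/2)"
    by (rule power2_le_imp_le) simp
qed

text \<open>
  The semigroup law up to the boundary. As \<open>boundary_kernel u\<close> is odd, the image term of the Dirichlet
  kernel unfolds the integral to the whole line, where it becomes the first moment of a Gaussian
  after completing the square.
\<close>

lemma heat_kernel_boundary_kernel:
  assumes t: "0 < t" and u: "0 < u"
  shows "has_bochner_integral half_line (\<lambda>y. heat_kernel t x y * boundary_kernel u y)
           (boundary_kernel (t + u) x)"
proof -
  define G where "G s y = normal_density 0 (sqrt (2 * s)) y" for s y :: real
  have G: "G s y = 1 / sqrt (4 * pi * s) * exp (- y\<^sup>2 / (4 * s))" if "0 < s" for s y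
    using that by (simp add: G_def normal_density_def)
  have sqrt_pi: "sqrt (4 * pi * s) * s = 2 * sqrt pi * s powr (3/2)" if "0 < s" for s
  proof -
    have "s powr (3/2) = s * s powr (1/2)"
      using that by (subst powr_mult_base) auto
    then show ?thesis using that by (simp add: real_sqrt_mult powr_half_sqrt)
  qed
  have boundary_G: "boundary_kernel s y = y / s * G s y" if "0 < s" for s y
    using that by (simp add: boundary_kernel_def G sqrt_pi[symmetric])
  have heat_G: "heat_kernel t x y = G t (x - y) - G t (x + y)" for y
    using t by (simp add: heat_kernel_def G algebra_simps)
  \<comment> \<open>The integrand without its image term, on the whole line.\<close>
  define f where "f y = G t (x - y) * (y / u * G u y)" for y
  define m \<sigma> where "m = u * x / (t + u)" and "\<sigma> = sqrt (2 * (t * u / (t + u)))"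
  have \<sigma>: "0 < \<sigma>" using t u by (simp add: \<sigma>_def)
  have f_eq: "f y = G (t + u) x / u * (normal_density m \<sigma> y * y)" for y
  proof -
    have sq: "\<sigma>\<^sup>2 = 2 * (t * u / (t + u))" using t u by (simp add: \<sigma>_def)
    have e: "- (x - y)\<^sup>2 / (4 * t) + - y\<^sup>2 / (4 * u) = - x\<^sup>2 / (4 * (t + u)) + - (y - m)\<^sup>2 / (2 * \<sigma>\<^sup>2)"
    proof -
      have ne: "t \<noteq> 0" "u \<noteq> 0" "t + u \<noteq> 0" using t u by auto
      have a: "- (y - m)\<^sup>2 / (2 * \<sigma>\<^sup>2) = - (y * (t + u) - u * x)\<^sup>2 / (4 * t * u * (t + u))"
      proof -
        have "y - m = (y * (t + u) - u * x) / (t + u)"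
          using ne by (simp add: m_def field_simps)
        then show ?thesis
          unfolding sq using ne by (simp add: power_divide power2_eq_square[of "t + u"])
      qed
      have b: "- X / (4 * t) + - Y / (4 * u) = - ((u * X + t * Y) * (t + u)) / (4 * t * u * (t + u))" for X Y
      proof -
        have "- ((u * X + t * Y) * (t + u)) / (4 * t * u * (t + u)) = - (u * X + t * Y) / (4 * t * u)"
          using ne by (simp add: diff_divide_distrib add_divide_distrib)
        also have "\<dots> = - X / (4 * t) + - Y / (4 * u)"
          using ne(1,2) by (simp add: field_simps)
        finally show ?thesis by simp
      qed
      have c: "- X / (4 * (t + u)) + - Y / (4 * t * u * (t + u)) = - (t * u * X + Y) / (4 * t * u * (t + u))" for X Y
      proof -
        have "- (t * u * X) / (4 * t * u * (t + u)) = ((t * u) * - X) / ((t * u) * (4 * (t + u)))"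
          by (simp add: ac_simps)
        also have "\<dots> = - X / (4 * (t + u))"
          by (rule mult_divide_mult_cancel_left) (use ne in simp)
        finally show ?thesis
          by (simp add: add_divide_distrib diff_divide_distrib)
      qed
      show ?thesis unfolding a b c by (simp add: power2_eq_square algebra_simps)
    qed
    \<comment> \<open>The normalising constants match the completed square.\<close>
    have s: "sqrt (4 * pi * t) * sqrt (4 * pi * u) = sqrt (4 * pi * (t + u)) * sqrt (2 * pi * \<sigma>\<^sup>2)"
      unfolding sq real_sqrt_mult[symmetric] using t u by (simp add: field_simps)
    have "f y = y / u * (exp (- (x - y)\<^sup>2 / (4 * t)) * exp (- y\<^sup>2 / (4 * u)) /
        (sqrt (4 * pi * t) * sqrt (4 * pi * u)))"
      using t u by (simp add: f_def G ac_simps)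
    also have "\<dots> = y / u * (exp (- x\<^sup>2 / (4 * (t + u))) * exp (- (y - m)\<^sup>2 / (2 * \<sigma>\<^sup>2)) /
        (sqrt (4 * pi * (t + u)) * sqrt (2 * pi * \<sigma>\<^sup>2)))"
      by (simp only: s e exp_add[symmetric])
    also have "\<dots> = G (t + u) x / u * (normal_density m \<sigma> y * y)"
      using t u by (simp add: G normal_density_def ac_simps)
    finally show ?thesis .
  qed
  have "has_bochner_integral lborel f (G (t + u) x / u * m)"
    unfolding f_eq using normal_moment_nz_1[OF \<sigma>] by (rule has_bochner_integral_mult_right)
  also have "G (t + u) x / u * m = boundary_kernel (t + u) x"
    using t u by (simp add: boundary_G m_def)
  finally have f_int: "has_bochner_integral lborel f (boundary_kernel (t + u) x)" .
  have f: "integrable lborel f" and If: "integral\<^sup>L lborel f = boundary_kernel (t + u) x"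
    using f_int by (auto simp: has_bochner_integral_iff)
  have f1: "integrable lborel (\<lambda>y. indicator {0<..} y * f y)"
    and f2: "integrable lborel (\<lambda>y. indicator {..<0} y * f y)"
    using f by (auto intro: integrable_real_mult_indicator simp: mult.commute)
  have f3: "integrable lborel (\<lambda>y. indicator {0<..} y * f (- y))"
    using lborel_integrable_real_affine[OF f2, of "-1" 0] by (simp add: indicator_def)
  have If3: "(LINT y|lborel. indicator {0<..} y * f (- y)) = (LINT y|lborel. indicator {..<0} y * f y)"
    using lborel_integral_real_affine[of "-1" "\<lambda>y. indicator {..<0} y * f y" 0] by (simp add: indicator_def)
  have split: "indicator {0<..} y * (heat_kernel t x y * boundary_kernel u y) =
      indicator {0<..} y * f y + indicator {0<..} y * f (- y)" for y
    using u by (simp add: heat_G boundary_G f_def G algebra_simps diff_divide_distrib)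
  have "has_bochner_integral lborel (\<lambda>y. indicator {0<..} y * f y + indicator {0<..} y * f (- y))
      (boundary_kernel (t + u) x)"
    unfolding has_bochner_integral_iff
  proof
    have "(LINT y|lborel. indicator {0<..} y * f y + indicator {0<..} y * f (- y)) =
        (LINT y|lborel. indicator {0<..} y * f y + indicator {..<0} y * f y)"
      using f1 f2 f3 by (simp add: If3)
    also have "\<dots> = integral\<^sup>L lborel f"
      using f1 f2 f by (intro integral_cong_AE) (auto intro!: AE_I[where N="{0}"] simp: indicator_def)
    finally show "(LINT y|lborel. indicator {0<..} y * f y + indicator {0<..} y * f (- y)) =
        boundary_kernel (t + u) x" by (simp add: If)
  qed (use f1 f3 in auto)
  then have "has_bochner_integral lborel
      (\<lambda>y. indicator {0<..} y *\<^sub>R (heat_kernel t x y * boundary_kernel u y)) (boundary_kernel (t + u) x)"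
    by (simp add: split)
  then show ?thesis
    unfolding half_line_def by (subst has_bochner_integral_restrict_space) auto
qed

lemma heat_kernel_nonneg:
  assumes "0 < t" "0 < x" "0 < y"
  shows "0 \<le> heat_kernel t x y"
proof -
  have "(x - y)\<^sup>2 \<le> (x + y)\<^sup>2" using assms by (simp add: power2_eq_square algebra_simps)
  then show ?thesis using assms by (auto simp: heat_kernel_def divide_right_mono)
qed

section \<open>The Laplace transform of the boundary kernel\<close>

lemma std_normal_cdf_derivative:
  "(cdf (density lborel (\<lambda>x. ennreal (std_normal_density x))) has_real_derivative std_normal_density x) (at x)"
proof -
  let ?N = "density lborel (\<lambda>x. ennreal (std_normal_density x))"
  interpret prob_space ?N by (rule prob_space_normal_density) simp
  interpret real_distribution ?N by unfold_locales simp
  have cdf_eq: "cdf ?N y = cdf ?N (x - 1) + integral {x - 1..y} std_normal_density" if "x - 1 \<le> y" for y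
  proof (cases "x - 1 = y")
    case False
    then have less: "x - 1 < y" using that by simp
    have int: "set_integrable lborel {x - 1..y} std_normal_density"
      by (intro borel_integrable_atLeastAtMost') (auto simp: normal_density_def intro!: continuous_intros)
    have "measure ?N {x - 1<..y} = measure ?N {x - 1..y}"
    proof (rule measure_eq_AE)
      show "AE z in ?N. (z \<in> {x - 1<..y}) = (z \<in> {x - 1..y})"
        by (subst AE_density) (auto intro!: AE_I[where N="{x - 1}"] simp: order_less_le)
    qed auto
    also have "\<dots> = (LINT z|lborel. std_normal_density z * indicator {x - 1..y} z)"
      using integral_density[of "\<lambda>z. indicator {x - 1..y} z :: real" lborel std_normal_density]
      by (simp add: Bochner_Integration.integral_indicator)
    also have "\<dots> = (LINT z:{x - 1..y}|lborel. std_normal_density z)"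
      by (simp add: set_lebesgue_integral_def mult.commute)
    also have "\<dots> = integral {x - 1..y} std_normal_density"
      using int by (rule set_borel_integral_eq_integral)
    finally show ?thesis using cdf_diff_eq[OF less] by simp
  qed simp
  have "((\<lambda>y. cdf ?N (x - 1) + integral {x - 1..y} std_normal_density) has_real_derivative std_normal_density x)
      (at x within {x - 1..x + 1})"
  proof -
    have "continuous_on {x - 1..x + 1} std_normal_density"
      by (auto simp: normal_density_def intro!: continuous_intros)
    then have "((\<lambda>y. integral {x - 1..y} std_normal_density) has_real_derivative std_normal_density x)
        (at x within {x - 1..x + 1})"
      by (rule integral_has_real_derivative) simp
    from DERIV_add[OF DERIV_const[of "cdf ?N (x - 1)"] this] show ?thesis
      by (simp only: add_0_left)
  qed
  then have "((\<lambda>y. cdf ?N (x - 1) + integral {x - 1..y} std_normal_density) has_real_derivative std_normal_density x) (at x)"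
    by (subst (asm) at_within_Icc_at) auto
  then show ?thesis
  proof (rule has_field_derivative_transform_within_open)
    show "cdf ?N (x - 1) + integral {x - 1..y} std_normal_density = cdf ?N y" if "y \<in> {x - 1<..}" for y
      using cdf_eq[of y] that by simp
  qed auto
qed

text \<open>
  The Laplace transform of the first passage density. The antiderivative \<open>F\<close> is the distribution
  function of the first passage time of a Brownian motion with drift towards \<open>0\<close>, multiplied by
  \<open>exp (- sqrt l * x)\<close>: the reflection principle expresses it through the normal distribution.
\<close>

lemma boundary_kernel_Laplace:
  assumes l: "0 < l" and x: "0 < x"
  shows "has_bochner_integral lborel (\<lambda>u. indicator {0<..} u * (exp (- l * u) * boundary_kernel u x)) (psi l x)"
proof -
  let ?N = "density lborel (\<lambda>x. ennreal (std_normal_density x))"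
  interpret prob_space ?N by (rule prob_space_normal_density) simp
  interpret real_distribution ?N by unfold_locales simp
  define b where "b = sqrt l"
  have b: "0 < b" "b * b = l" using l by (simp_all add: b_def)
  define F where "F u = exp (- (b * x)) * cdf ?N (b * sqrt (2 * u) - x / sqrt (2 * u)) +
    exp (b * x) * cdf ?N (- b * sqrt (2 * u) - x / sqrt (2 * u))" for u
  let ?f = "\<lambda>u. exp (- l * u) * boundary_kernel u x"
  have arg1: "((\<lambda>u. c * sqrt (2 * u) - x / sqrt (2 * u)) has_real_derivative
      (c / sqrt (2 * u) + x / (2 * u * sqrt (2 * u)))) (at u)" if "0 < u" for u c
    using that by (auto intro!: derivative_eq_intros simp: field_simps)
  \<comment> \<open>Used for \<open>c = b\<close> and \<open>c = - b\<close>: both Gaussian factors of the derivative of \<open>F\<close> agree.\<close>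
  have exponent: "exp (- (c * x)) * std_normal_density (c * sqrt (2 * u) - x / sqrt (2 * u)) =
      exp (- l * u) * exp (- x\<^sup>2 / (4 * u)) / sqrt (2 * pi)" if "0 < u" "c * c = l" for u c
  proof -
    define s where "s = sqrt (2 * u)"
    have s: "0 < s" "s * s = 2 * u" using that by (simp_all add: s_def)
    have "(c * s - x / s)\<^sup>2 = c * c * (s * s) - 2 * c * x + x\<^sup>2 / (s * s)"
      using s(1) by (simp add: field_simps power2_eq_square)
    then have "- (c * x) + - (c * s - x / s)\<^sup>2 / 2 = - l * u + - x\<^sup>2 / (4 * u)"
      unfolding s that(2) by (simp add: field_simps)
    then show ?thesis
      unfolding std_normal_density_def s_def[symmetric] by (simp add: exp_add[symmetric])
  qed
  have DF: "(F has_real_derivative ?f u) (at u)" if u: "0 < u" for u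
  proof -
    have su: "0 < sqrt (2 * u)" using u by simp
    have D: "((\<lambda>u. exp (- (c * x)) * cdf ?N (c * sqrt (2 * u) - x / sqrt (2 * u))) has_real_derivative
        exp (- l * u) * exp (- x\<^sup>2 / (4 * u)) / sqrt (2 * pi) * (c / sqrt (2 * u) + x / (2 * u * sqrt (2 * u)))) (at u)"
      if "c * c = l" for c
      using DERIV_cmult[OF DERIV_chain2[OF std_normal_cdf_derivative arg1[OF u, of c]], of "exp (- (c * x))"]
        exponent[OF u that] by (simp add: mult.assoc[symmetric])
    have "(F has_real_derivative
        exp (- l * u) * exp (- x\<^sup>2 / (4 * u)) / sqrt (2 * pi) * (b / sqrt (2 * u) + x / (2 * u * sqrt (2 * u))) +
        exp (- l * u) * exp (- x\<^sup>2 / (4 * u)) / sqrt (2 * pi) * (- b / sqrt (2 * u) + x / (2 * u * sqrt (2 * u)))) (at u)"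
      using DERIV_add[OF D[of b] D[of "- b"]] b unfolding F_def[abs_def] by simp
    also have "exp (- l * u) * exp (- x\<^sup>2 / (4 * u)) / sqrt (2 * pi) * (b / sqrt (2 * u) + x / (2 * u * sqrt (2 * u))) +
        exp (- l * u) * exp (- x\<^sup>2 / (4 * u)) / sqrt (2 * pi) * (- b / sqrt (2 * u) + x / (2 * u * sqrt (2 * u))) =
        exp (- l * u) * (x / (sqrt (2 * pi) * u * sqrt (2 * u)) * exp (- x\<^sup>2 / (4 * u)))"
      using u by (simp add: field_simps)
    also have "sqrt (2 * pi) * u * sqrt (2 * u) = 2 * sqrt pi * u powr (3/2)"
      using u powr_add[of u 1 "1/2"] by (simp add: real_sqrt_mult powr_half_sqrt)
    finally show ?thesis by (simp add: boundary_kernel_def)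
  qed
  have cont: "isCont ?f u" if "0 < u" for u
    using that unfolding boundary_kernel_def by (auto intro!: continuous_intros)
  have bot: "filterlim (\<lambda>u. c * sqrt (2 * u) - x / sqrt (2 * u)) at_bot (at_right 0)" for c
    using x by real_asymp
  have bot': "filterlim (\<lambda>u. - b * sqrt (2 * u) - x / sqrt (2 * u)) at_bot at_top"
    using x b(1) by real_asymp
  have top: "filterlim (\<lambda>u. b * sqrt (2 * u) - x / sqrt (2 * u)) at_top at_top"
    using x b(1) by real_asymp
  have "(F \<longlongrightarrow> exp (- (b * x)) * 0 + exp (b * x) * 0) (at_right 0)"
    unfolding F_def[abs_def]
    by (intro tendsto_intros filterlim_compose[OF cdf_lim_at_bot] bot)
  then have A: "((F \<circ> real_of_ereal) \<longlongrightarrow> 0) (at_right (ereal 0))"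
    by (simp add: ereal_tendsto_simps)
  have "(F \<longlongrightarrow> exp (- (b * x)) * 1 + exp (b * x) * 0) at_top"
    unfolding F_def[abs_def]
    by (intro tendsto_intros filterlim_compose[OF cdf_lim_at_bot] filterlim_compose[OF cdf_lim_at_top_prob] bot' top)
  then have B: "((F \<circ> real_of_ereal) \<longlongrightarrow> psi l x) (at_left \<infinity>)"
    by (simp add: ereal_tendsto_simps psi_def b_def)
  have nonneg: "AE u in lborel. ereal 0 < ereal u \<longrightarrow> ereal u < \<infinity> \<longrightarrow> 0 \<le> ?f u"
    using x by (simp add: boundary_kernel_nonneg)
  have Dom: "einterval (ereal 0) \<infinity> = {0<..}" by (auto simp: einterval_def)
  have "set_integrable lborel (einterval (ereal 0) \<infinity>) ?f" "(LBINT u=ereal 0..\<infinity>. ?f u) = psi l x - 0"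
    using interval_integral_FTC_nonneg[OF _ _ _ nonneg A B] DF cont by auto
  then show ?thesis
    by (simp add: interval_lebesgue_integral_def set_integrable_def set_lebesgue_integral_def
        has_bochner_integral_iff Dom mult.commute)
qed

section \<open>Gamma measures and their convolutions\<close>

text \<open>
  Not normalised to a probability density: integrating \<open>e^(tA)\<close> against it gives exactly \<open>(r - A)\<close> to
  the power \<open>- a\<close>. For \<open>a = 1\<close> it is the density whose integral is the resolvent.
\<close>

definition gamma_density :: "real \<Rightarrow> real \<Rightarrow> real \<Rightarrow> real" where
  "gamma_density a r t = indicator {0<..} t * (t powr (a - 1) / Gamma a * exp (- r * t))"

definition gamma_measure :: "real \<Rightarrow> real \<Rightarrow> real measure" where
  "gamma_measure a r = density lborel (\<lambda>t. ennreal (gamma_density a r t))"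

lemma gamma_density_measurable [measurable]: "gamma_density a r \<in> borel_measurable borel"
  unfolding gamma_density_def[abs_def] by measurable

lemma gamma_density_nonneg: "0 < a \<Longrightarrow> 0 \<le> gamma_density a r t"
  by (simp add: gamma_density_def Gamma_real_nonneg)

lemma sets_gamma_measure [simp, measurable_cong]: "sets (gamma_measure a r) = sets borel"
  by (simp add: gamma_measure_def)

lemma space_gamma_measure [simp]: "space (gamma_measure a r) = UNIV"
  by (simp add: gamma_measure_def)

lemma AE_gamma_measure_pos: "AE t in gamma_measure a r. 0 < t"
  unfolding gamma_measure_def
  by (subst AE_density) (auto simp: gamma_density_def indicator_def)

lemma nn_integral_powr_exp:
  assumes a: "0 < a" and r: "0 < r"
  shows "(\<integral>\<^sup>+t. ennreal (indicator {0<..} t * (t powr (a - 1) * exp (- r * t))) \<partial>lborel) =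
    ennreal (Gamma a / r powr a)"
proof -
  have "(\<integral>\<^sup>+t. ennreal (indicator {0<..} t * (t powr (a - 1) * exp (- t))) \<partial>lborel) = ennreal (Gamma a)"
  proof -
    have "(\<integral>\<^sup>+t. ennreal (indicator {0<..} t * (t powr (a - 1) * exp (- t))) \<partial>lborel) =
        (\<integral>\<^sup>+t. ennreal (indicator {0..} t * t powr (a - 1) / exp t) \<partial>lborel)"
      by (intro nn_integral_cong_AE AE_I[where N="{0}"]) (auto simp: indicator_def exp_minus field_simps)
    then show ?thesis using Gamma_conv_nn_integral_real[OF a] by simp
  qed
  then have "ennreal (Gamma a) = (\<integral>\<^sup>+t. ennreal \<bar>r\<bar> * ennreal (indicator {0<..} (0 + r * t) * ((0 + r * t) powr (a - 1) * exp (- (0 + r * t)))) \<partial>lborel)"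
    using nn_integral_real_affine[of "\<lambda>t. ennreal (indicator {0<..} t * (t powr (a - 1) * exp (- t)))" r 0] r
    by (simp add: nn_integral_cmult)
  also have "\<dots> = (\<integral>\<^sup>+t. ennreal (r powr a) * ennreal (indicator {0<..} t * (t powr (a - 1) * exp (- r * t))) \<partial>lborel)"
  proof (intro nn_integral_cong)
    fix t :: real
    have "r * ((r * t) powr (a - 1)) = r powr a * t powr (a - 1)" if "0 < t"
      using that r powr_add[of r 1 "a - 1"] by (simp add: powr_mult)
    then show "ennreal \<bar>r\<bar> * ennreal (indicator {0<..} (0 + r * t) * ((0 + r * t) powr (a - 1) * exp (- (0 + r * t)))) =
        ennreal (r powr a) * ennreal (indicator {0<..} t * (t powr (a - 1) * exp (- r * t)))"
      using r by (cases "0 < t") (auto simp: ennreal_mult[symmetric] zero_less_mult_iff mult.assoc[symmetric])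
  qed
  also have "\<dots> = ennreal (r powr a) * (\<integral>\<^sup>+t. ennreal (indicator {0<..} t * (t powr (a - 1) * exp (- r * t))) \<partial>lborel)"
    by (intro nn_integral_cmult) measurable
  finally have *: "ennreal (Gamma a) = ennreal (r powr a) *
    (\<integral>\<^sup>+t. ennreal (indicator {0<..} t * (t powr (a - 1) * exp (- r * t))) \<partial>lborel)" .
  have "ennreal (Gamma a / r powr a) = ennreal (1 / r powr a) * ennreal (Gamma a)"
    using a r by (simp add: ennreal_mult[symmetric] Gamma_real_nonneg)
  also have "\<dots> = ennreal (1 / r powr a) * ennreal (r powr a) *
    (\<integral>\<^sup>+t. ennreal (indicator {0<..} t * (t powr (a - 1) * exp (- r * t))) \<partial>lborel)"
    unfolding * by (simp add: mult.assoc)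
  also have "ennreal (1 / r powr a) * ennreal (r powr a) = 1"
    using r by (simp add: ennreal_mult[symmetric])
  finally show ?thesis by simp
qed

lemma integrable_gamma_measure_powr:
  assumes a: "0 < a" and r: "0 < r" and g: "g < a"
  shows "integrable (gamma_measure a r) (\<lambda>t. t powr (- g))"
proof (rule integrableI_nonneg)
  have "(\<integral>\<^sup>+t. ennreal (t powr (- g)) \<partial>gamma_measure a r) =
      (\<integral>\<^sup>+t. ennreal (gamma_density a r t) * ennreal (t powr (- g)) \<partial>lborel)"
    unfolding gamma_measure_def by (intro nn_integral_density) measurable
  also have "\<dots> = (\<integral>\<^sup>+t. ennreal (1 / Gamma a) * ennreal (indicator {0<..} t * (t powr ((a - g) - 1) * exp (- r * t))) \<partial>lborel)"
  proof (intro nn_integral_cong)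
    fix t :: real
    have "t powr (a - g - 1) = t powr (a - 1) * t powr (- g)"
      unfolding powr_add[symmetric] by (simp add: algebra_simps)
    then show "ennreal (gamma_density a r t) * ennreal (t powr (- g)) =
        ennreal (1 / Gamma a) * ennreal (indicator {0<..} t * (t powr ((a - g) - 1) * exp (- r * t)))"
      using a by (simp add: gamma_density_def ennreal_mult[symmetric] Gamma_real_nonneg ac_simps)
  qed
  also have "\<dots> = ennreal (1 / Gamma a) * ennreal (Gamma (a - g) / r powr (a - g))"
    using nn_integral_powr_exp[of "a - g" r] g r by (subst nn_integral_cmult) auto
  finally show "(\<integral>\<^sup>+t. ennreal (t powr (- g)) \<partial>gamma_measure a r) < \<infinity>"
    by (simp add: ennreal_mult_less_top)
qed (auto simp: AE_gamma_measure_pos)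

lemma finite_gamma_measure:
  assumes "0 < a" "0 < r"
  shows "finite_measure (gamma_measure a r)"
proof -
  have "AE t in gamma_measure a r. t powr (- 0) = (1::real)"
    using AE_gamma_measure_pos by eventually_elim simp
  then have "integrable (gamma_measure a r) (\<lambda>t. 1 :: real)"
    using integrable_gamma_measure_powr[OF assms assms(1)]
    by (rule integrable_cong_AE_imp[rotated 2]) auto
  then show ?thesis by (intro finite_measureI) (simp add: integrable_iff_bounded)
qed

lemma nn_integral_Beta:
  assumes a: "0 < a" and b: "0 < b" and x: "0 < x"
  shows "(\<integral>\<^sup>+y. ennreal (indicator {0<..<x} y * ((x - y) powr (a - 1) * y powr (b - 1))) \<partial>lborel) =
    ennreal (x powr (a + b - 1) * Beta a b)"
proof -
  have "(\<integral>\<^sup>+t. ennreal (t powr (b - 1) * (1 - t) powr (a - 1)) * indicator {0..1} t \<partial>lborel) = ennreal (Beta b a)"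
    using has_integral_Beta_real[OF b a] by (intro nn_integral_has_integral_lebesgue') auto
  also have "(\<integral>\<^sup>+t. ennreal (t powr (b - 1) * (1 - t) powr (a - 1)) * indicator {0..1} t \<partial>lborel) =
      (\<integral>\<^sup>+t. ennreal (indicator {0<..<1} t * ((1 - t) powr (a - 1) * t powr (b - 1))) \<partial>lborel)"
  proof (rule nn_integral_cong_AE)
    show "AE t in lborel. ennreal (t powr (b - 1) * (1 - t) powr (a - 1)) * indicator {0..1} t =
        ennreal (indicator {0<..<1} t * ((1 - t) powr (a - 1) * t powr (b - 1)))"
      using AE_lborel_singleton[of 0] AE_lborel_singleton[of 1]
      by eventually_elim (auto simp: indicator_def ac_simps)
  qed
  finally have unit: "(\<integral>\<^sup>+t. ennreal (indicator {0<..<1} t * ((1 - t) powr (a - 1) * t powr (b - 1))) \<partial>lborel) = ennreal (Beta a b)"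
    by (simp add: Beta_commute)
  have "(\<integral>\<^sup>+y. ennreal (indicator {0<..<x} y * ((x - y) powr (a - 1) * y powr (b - 1))) \<partial>lborel) =
      ennreal x * (\<integral>\<^sup>+t. ennreal (indicator {0<..<x} (x * t) * ((x - x * t) powr (a - 1) * (x * t) powr (b - 1))) \<partial>lborel)"
    using nn_integral_real_affine[of "\<lambda>y. ennreal (indicator {0<..<x} y * ((x - y) powr (a - 1) * y powr (b - 1)))" x 0] x
    by simp
  also have "(\<integral>\<^sup>+t. ennreal (indicator {0<..<x} (x * t) * ((x - x * t) powr (a - 1) * (x * t) powr (b - 1))) \<partial>lborel) =
      (\<integral>\<^sup>+t. ennreal (x powr (a + b - 2)) * ennreal (indicator {0<..<1} t * ((1 - t) powr (a - 1) * t powr (b - 1))) \<partial>lborel)"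
  proof (intro nn_integral_cong)
    fix t :: real
    show "ennreal (indicator {0<..<x} (x * t) * ((x - x * t) powr (a - 1) * (x * t) powr (b - 1))) =
        ennreal (x powr (a + b - 2)) * ennreal (indicator {0<..<1} t * ((1 - t) powr (a - 1) * t powr (b - 1)))"
    proof (cases "0 < t \<and> t < 1")
      case True
      have "(x - x * t) powr (a - 1) = x powr (a - 1) * (1 - t) powr (a - 1)"
        using True x powr_mult[of x "1 - t" "a - 1"] by (simp add: algebra_simps)
      moreover have "(x * t) powr (b - 1) = x powr (b - 1) * t powr (b - 1)"
        using True x by (simp add: powr_mult)
      moreover have "x powr (a - 1) * x powr (b - 1) = x powr (a + b - 2)"
        by (simp flip: powr_add)
      ultimately show ?thesis
        using True x by (simp add: ennreal_mult[symmetric] mult_less_cancel_left2 algebra_simps)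
    next
      case False
      then show ?thesis using x by (auto simp: indicator_def zero_less_mult_iff)
    qed
  qed
  also have "\<dots> = ennreal (x powr (a + b - 2)) * ennreal (Beta a b)"
    by (subst nn_integral_cmult) (auto simp: unit)
  also have "ennreal x * (ennreal (x powr (a + b - 2)) * ennreal (Beta a b)) = ennreal (x * x powr (a + b - 2) * Beta a b)"
    using x a b by (simp add: ennreal_mult'[symmetric] ennreal_mult[symmetric] Beta_def Gamma_real_nonneg mult.assoc)
  also have "x * x powr (a + b - 2) = x powr (a + b - 1)"
    using x powr_add[of x 1 "a + b - 2"] by simp
  finally show ?thesis .
qed

text \<open>
  The additivity of the exponents of negative fractional powers of \<open>r - A\<close>, on the level of
  measures; it is Euler's Beta integral.
\<close>

lemma gamma_measure_convolution:
  assumes a: "0 < a" and b: "0 < b" and r: "0 < r"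
  shows "gamma_measure a r \<star> gamma_measure b r = gamma_measure (a + b) r"
proof -
  have "gamma_measure a r \<star> gamma_measure b r =
      density lborel (\<lambda>x. \<integral>\<^sup>+y. ennreal (gamma_density a r (x - y)) * ennreal (gamma_density b r y) \<partial>lborel)"
    unfolding gamma_measure_def
    using finite_gamma_measure[OF a r] finite_gamma_measure[OF b r]
    by (intro convolution_density) (simp_all add: gamma_measure_def)
  also have "(\<lambda>x. \<integral>\<^sup>+y. ennreal (gamma_density a r (x - y)) * ennreal (gamma_density b r y) \<partial>lborel) =
      (\<lambda>x. ennreal (gamma_density (a + b) r x))"
  proof
    fix x :: real
    define C where "C = exp (- r * x) / (Gamma a * Gamma b)"
    have C: "0 \<le> C" using a b by (simp add: C_def Gamma_real_nonneg)
    have "(\<integral>\<^sup>+y. ennreal (gamma_density a r (x - y)) * ennreal (gamma_density b r y) \<partial>lborel) =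
        (\<integral>\<^sup>+y. ennreal C * ennreal (indicator {0<..<x} y * ((x - y) powr (a - 1) * y powr (b - 1))) \<partial>lborel)"
    proof (intro nn_integral_cong)
      fix y :: real
      have "gamma_density a r (x - y) * gamma_density b r y =
          C * (indicator {0<..<x} y * ((x - y) powr (a - 1) * y powr (b - 1)))"
        by (auto simp: gamma_density_def C_def indicator_def exp_add[symmetric] algebra_simps)
      then show "ennreal (gamma_density a r (x - y)) * ennreal (gamma_density b r y) =
          ennreal C * ennreal (indicator {0<..<x} y * ((x - y) powr (a - 1) * y powr (b - 1)))"
        using C a b by (simp add: ennreal_mult[symmetric] gamma_density_nonneg)
    qed
    also have "\<dots> = ennreal C * (\<integral>\<^sup>+y. ennreal (indicator {0<..<x} y * ((x - y) powr (a - 1) * y powr (b - 1))) \<partial>lborel)"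
      by (intro nn_integral_cmult) measurable
    also have "\<dots> = ennreal (gamma_density (a + b) r x)"
    proof (cases "0 < x")
      case True
      then show ?thesis
        using nn_integral_Beta[OF a b True] C Gamma_real_pos[OF a] Gamma_real_pos[OF b]
        by (simp add: ennreal_mult'[symmetric] gamma_density_def C_def Beta_def mult.commute)
    next
      case False
      then have "indicator {0<..<x} y = (0::real)" for y by (auto simp: indicator_def)
      then show ?thesis using False by (simp add: gamma_density_def)
    qed
    finally show "(\<integral>\<^sup>+y. ennreal (gamma_density a r (x - y)) * ennreal (gamma_density b r y) \<partial>lborel) =
        ennreal (gamma_density (a + b) r x)" .
  qed
  finally show ?thesis by (simp add: gamma_measure_def)
qed

lemma gamma_density_1: "gamma_density 1 r t = indicator {0<..} t * exp (- r * t)"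
  by (simp add: gamma_density_def indicator_def)

text \<open>
  The resolvent identity on the level of measures.
\<close>

lemma exponential_convolution:
  assumes r: "0 < r" and l: "0 < l" and ne: "r \<noteq> l"
  shows "gamma_measure 1 r \<star> gamma_measure 1 l =
    density lborel (\<lambda>x. ennreal ((gamma_density 1 l x - gamma_density 1 r x) / (r - l)))"
proof -
  have "gamma_measure 1 r \<star> gamma_measure 1 l =
      density lborel (\<lambda>x. \<integral>\<^sup>+y. ennreal (gamma_density 1 r (x - y)) * ennreal (gamma_density 1 l y) \<partial>lborel)"
    unfolding gamma_measure_def
    using finite_gamma_measure[of 1 r] finite_gamma_measure[of 1 l] r l
    by (intro convolution_density) (simp_all add: gamma_measure_def)
  also have "\<dots> = density lborel (\<lambda>x. ennreal ((gamma_density 1 l x - gamma_density 1 r x) / (r - l)))"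
  proof (intro density_cong)
    show "AE x in lborel. (\<integral>\<^sup>+y. ennreal (gamma_density 1 r (x - y)) * ennreal (gamma_density 1 l y) \<partial>lborel) =
        ennreal ((gamma_density 1 l x - gamma_density 1 r x) / (r - l))"
    proof (rule AE_I2)
      fix x :: real
      let ?f = "\<lambda>y. exp (- r * x) * exp ((r - l) * y)"
      have "(\<integral>\<^sup>+y. ennreal (gamma_density 1 r (x - y)) * ennreal (gamma_density 1 l y) \<partial>lborel) =
          (\<integral>\<^sup>+y. ennreal (?f y) * indicator {0..x} y \<partial>lborel)"
      proof (rule nn_integral_cong_AE)
        show "AE y in lborel. ennreal (gamma_density 1 r (x - y)) * ennreal (gamma_density 1 l y) =
            ennreal (?f y) * indicator {0..x} y"
          using AE_lborel_singleton[of 0] AE_lborel_singleton[of x]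
          by eventually_elim
             (auto simp: gamma_density_1 ennreal_mult[symmetric] indicator_def exp_add[symmetric] algebra_simps)
      qed
      also have "\<dots> = ennreal ((gamma_density 1 l x - gamma_density 1 r x) / (r - l))"
      proof (cases "0 < x")
        case True
        have "(\<integral>\<^sup>+y. ennreal (?f y) * indicator {0..x} y \<partial>lborel) =
            exp (- r * x) * exp ((r - l) * x) / (r - l) - exp (- r * x) * exp ((r - l) * 0) / (r - l)"
        proof (rule nn_integral_FTC_Icc)
          show "((\<lambda>y. exp (- r * x) * exp ((r - l) * y) / (r - l)) has_real_derivative ?f y) (at y)" for y
            using ne by (auto intro!: derivative_eq_intros)
        qed (use True in auto)
        also have "exp (- r * x) * exp ((r - l) * x) = exp (- l * x)"
          by (simp add: exp_add[symmetric] algebra_simps)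
        finally show ?thesis using True by (simp add: gamma_density_1 diff_divide_distrib)
      next
        case False
        then have "AE y in lborel. y \<notin> {0..x}"
          by (intro AE_I[where N="{0}"]) auto
        then have "(\<integral>\<^sup>+y. ennreal (?f y) * indicator {0..x} y \<partial>lborel) = (\<integral>\<^sup>+y. 0 \<partial>(lborel :: real measure))"
          by (intro nn_integral_cong_AE) (auto elim!: eventually_mono)
        then show ?thesis using False by (simp add: gamma_density_1)
      qed
      finally show "(\<integral>\<^sup>+y. ennreal (gamma_density 1 r (x - y)) * ennreal (gamma_density 1 l y) \<partial>lborel) =
        ennreal ((gamma_density 1 l x - gamma_density 1 r x) / (r - l))" .
    qed
  qed measurable
  finally show ?thesis .
qed

section \<open>Averages of the boundary kernel\<close>

text \<open>
  For fixed \<open>x\<close> the Gaussian factor beats the singularity at \<open>u = 0\<close>, so that every finite measure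
  integrates the kernel pointwise.
\<close>

lemma boundary_kernel_le:
  assumes u: "0 < u" and x: "0 < x"
  shows "boundary_kernel u x \<le> 8 / x\<^sup>2"
proof -
  define y where "y = x\<^sup>2 / (4 * u)"
  have y: "0 < y" using u x by (simp add: y_def)
  define s where "s = sqrt u"
  have s: "0 < s" "u = s * s" using u by (simp_all add: s_def)
  have "sqrt y = x / (2 * s)"
    using u x by (simp add: y_def s_def real_sqrt_divide real_sqrt_mult)
  moreover have "y = x\<^sup>2 / (4 * (s * s))"
    by (simp only: y_def s(2))
  moreover have "y powr (3/2) = y * sqrt y"
    using y powr_add[of y 1 "1/2"] by (simp add: powr_half_sqrt)
  ultimately have "y powr (3/2) = x\<^sup>2 / (4 * (s * s)) * (x / (2 * s))"
    by simp
  then have "y powr (3/2) = x ^ 3 / (8 * s ^ 3)"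
    by (simp add: power2_eq_square power3_eq_cube)
  moreover have "u powr (3/2) = s ^ 3"
    using u powr_add[of u 1 "1/2"] by (simp add: powr_half_sqrt s_def power3_eq_cube)
  ultimately have "x / (2 * sqrt pi * u powr (3/2)) = 4 / (sqrt pi * x\<^sup>2) * y powr (3/2)"
    using x s(1) by (simp add: field_simps power2_eq_square power3_eq_cube)
  then have "boundary_kernel u x = 4 / (sqrt pi * x\<^sup>2) * (y powr (3/2) * exp (- y))"
    by (simp add: boundary_kernel_def y_def)
  also have "\<dots> \<le> 4 / (sqrt pi * x\<^sup>2) * (2 * exp y * exp (- y))"
    using y by (intro mult_left_mono mult_right_mono powr_le_exp) auto
  also have "\<dots> = 8 / (sqrt pi * x\<^sup>2)"
    by (simp add: exp_minus)
  also have "\<dots> \<le> 8 / (1 * x\<^sup>2)"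
    using x pi_ge_two by (intro divide_left_mono mult_right_mono) auto
  finally show ?thesis by simp
qed

lemma psi_eq_boundary_average:
  assumes "0 < l" "0 < x"
  shows "(LINT u|gamma_measure 1 l. boundary_kernel u x) = psi l x"
proof -
  have "(LINT u|gamma_measure 1 l. boundary_kernel u x) =
      (LINT u|lborel. gamma_density 1 l u *\<^sub>R boundary_kernel u x)"
    unfolding gamma_measure_def by (intro integral_density) (auto simp: gamma_density_nonneg)
  also have "\<dots> = psi l x"
    using boundary_kernel_Laplace[OF assms]
    by (simp add: gamma_density_1 has_bochner_integral_iff mult.assoc)
  finally show ?thesis .
qed

lemma psi_difference_eq_boundary_average:
  assumes r: "0 < r" and l: "0 < l" and ne: "r \<noteq> l" and x: "0 < x"
  shows "(LINT u|(gamma_measure 1 r \<star> gamma_measure 1 l). boundary_kernel u x) = (psi l x - psi r x) / (r - l)"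
proof -
  have nonneg: "0 \<le> (gamma_density 1 l u - gamma_density 1 r u) / (r - l)" for u
  proof (cases "0 < u \<and> l < r")
    case True
    then show ?thesis by (simp add: gamma_density_1)
  next
    case False
    then show ?thesis using ne
      by (cases "0 < u") (auto simp: gamma_density_1 intro!: divide_nonpos_neg)
  qed
  have int: "integrable lborel (\<lambda>u. gamma_density 1 k u * boundary_kernel u x)"
    "(LINT u|lborel. gamma_density 1 k u * boundary_kernel u x) = psi k x" if "0 < k" for k
    using boundary_kernel_Laplace[OF that x]
    by (simp_all add: gamma_density_1 has_bochner_integral_iff mult.assoc)
  have "(LINT u|(gamma_measure 1 r \<star> gamma_measure 1 l). boundary_kernel u x) =
      (LINT u|lborel. ((gamma_density 1 l u - gamma_density 1 r u) / (r - l)) *\<^sub>R boundary_kernel u x)"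
    unfolding exponential_convolution[OF r l ne] using nonneg by (intro integral_density) auto
  also have "\<dots> = (LINT u|lborel. (gamma_density 1 l u * boundary_kernel u x - gamma_density 1 r u * boundary_kernel u x) / (r - l))"
    by (simp add: algebra_simps)
  also have "\<dots> = (psi l x - psi r x) / (r - l)"
    using int[OF l] int[OF r] by simp
  finally show ?thesis .
qed

text \<open>
  When the norm of \<open>boundary_kernel u\<close> grows at most like \<open>u powr (- g)\<close>, the last condition
  makes the average of the kernels over \<open>\<mu>\<close> square-integrable.
\<close>

definition admissible :: "real \<Rightarrow> real measure \<Rightarrow> bool" where
  "admissible g \<mu> \<longleftrightarrow> finite_measure \<mu> \<and> sets \<mu> = sets borel \<and> (AE u in \<mu>. 0 < u) \<and>
     integrable \<mu> (\<lambda>u. u powr (- g))"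

lemma admissible_gamma_measure:
  "0 < a \<Longrightarrow> 0 < r \<Longrightarrow> g < a \<Longrightarrow> admissible g (gamma_measure a r)"
  by (simp add: admissible_def finite_gamma_measure AE_gamma_measure_pos integrable_gamma_measure_powr)

lemma admissible_convolution:
  assumes \<nu>: "finite_measure \<nu>" "sets \<nu> = sets borel" "AE t in \<nu>. 0 < t"
    and \<mu>: "admissible g \<mu>" and g: "0 \<le> g"
  shows "admissible g (\<nu> \<star> \<mu>)"
proof -
  note [measurable_cong] = \<nu>(2)
  have \<mu>': "finite_measure \<mu>" "AE u in \<mu>. 0 < u" "integrable \<mu> (\<lambda>u. u powr (- g))"
    and [measurable_cong]: "sets \<mu> = sets borel"
    using \<mu> by (auto simp: admissible_def)
  interpret \<nu>: finite_measure \<nu> by fact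
  interpret \<mu>: finite_measure \<mu> by fact
  have fin: "finite_measure (\<nu> \<star> \<mu>)"
    using \<nu> \<mu>' \<open>sets \<mu> = sets borel\<close> by (intro convolution_finite) auto
  have "(\<integral>\<^sup>+z. indicator {..0} z \<partial>(\<nu> \<star> \<mu>)) = (\<integral>\<^sup>+t. \<integral>\<^sup>+u. indicator {..0} (t + u) \<partial>\<mu> \<partial>\<nu>)"
    using \<nu> \<mu>' \<open>sets \<mu> = sets borel\<close> by (intro nn_integral_convolution) auto
  also have "\<dots> = (\<integral>\<^sup>+t. 0 \<partial>\<nu>)"
  proof (rule nn_integral_cong_AE)
    show "AE t in \<nu>. (\<integral>\<^sup>+u. indicator {..0} (t + u) \<partial>\<mu>) = 0"
      using \<nu>(3)
    proof eventually_elim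
      case (elim t)
      have "(\<integral>\<^sup>+u. indicator {..0} (t + u) \<partial>\<mu>) = (\<integral>\<^sup>+u. 0 \<partial>\<mu>)"
        using \<mu>'(2) elim by (intro nn_integral_cong_AE) (auto simp: indicator_def)
      then show ?case by simp
    qed
  qed
  finally have "(\<integral>\<^sup>+z. indicator {..0} z \<partial>(\<nu> \<star> \<mu>)) = 0"
    by (simp del: nn_integral_indicator)
  then have "AE z in \<nu> \<star> \<mu>. indicator {..0} z = (0::ennreal)"
    using nn_integral_0_iff_AE[of "indicator {..0}" "\<nu> \<star> \<mu>"] by (simp del: nn_integral_indicator)
  then have pos: "AE z in \<nu> \<star> \<mu>. 0 < z"
    by eventually_elim (auto simp: indicator_def split: if_splits)
  have "integrable (\<nu> \<star> \<mu>) (\<lambda>z. z powr (- g))"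
  proof (rule integrableI_nonneg)
    have "(\<integral>\<^sup>+z. ennreal (z powr (- g)) \<partial>(\<nu> \<star> \<mu>)) = (\<integral>\<^sup>+t. \<integral>\<^sup>+u. ennreal ((t + u) powr (- g)) \<partial>\<mu> \<partial>\<nu>)"
      using \<nu> \<mu>' \<open>sets \<mu> = sets borel\<close> by (intro nn_integral_convolution) auto
    also have "\<dots> \<le> (\<integral>\<^sup>+t. (\<integral>\<^sup>+u. ennreal (u powr (- g)) \<partial>\<mu>) \<partial>\<nu>)"
    proof (rule nn_integral_mono_AE)
      show "AE t in \<nu>. (\<integral>\<^sup>+u. ennreal ((t + u) powr (- g)) \<partial>\<mu>) \<le> (\<integral>\<^sup>+u. ennreal (u powr (- g)) \<partial>\<mu>)"
        using \<nu>(3)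
      proof eventually_elim
        case (elim t)
        show ?case
          using \<mu>'(2) elim g by (intro nn_integral_mono_AE) (auto intro!: ennreal_leI powr_mono2')
      qed
    qed
    also have "\<dots> = (\<integral>\<^sup>+u. ennreal (u powr (- g)) \<partial>\<mu>) * emeasure \<nu> (space \<nu>)"
      by simp
    also have "\<dots> < \<infinity>"
      using \<mu>'(3) \<nu>.emeasure_finite[of "space \<nu>"]
      by (auto simp: integrable_iff_bounded less_top[symmetric] ennreal_mult_eq_top_iff)
    finally show "(\<integral>\<^sup>+z. ennreal (z powr (- g)) \<partial>(\<nu> \<star> \<mu>)) < \<infinity>" .
  qed auto
  with fin pos show ?thesis by (simp add: admissible_def)
qed

lemma admissible_density_indicator:
  assumes \<mu>: "admissible g \<mu>" and A [measurable]: "A \<in> sets borel"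
    and h: "\<And>u. u \<in> A \<Longrightarrow> 0 < u \<Longrightarrow> u powr (- h) \<le> C * u powr (- g)"
  shows "admissible h (density \<mu> (indicator A))"
proof -
  have \<mu>': "finite_measure \<mu>" "AE u in \<mu>. 0 < u" "integrable \<mu> (\<lambda>u. u powr (- g))"
    and [measurable_cong]: "sets \<mu> = sets borel"
    using \<mu> by (auto simp: admissible_def)
  interpret finite_measure \<mu> by fact
  have "finite_measure (density \<mu> (indicator A))"
    by (intro finite_measureI) (simp add: emeasure_restricted)
  moreover have "AE u in density \<mu> (indicator A). 0 < u"
    using \<mu>'(2) by (subst AE_density) auto
  moreover have "integrable (density \<mu> (\<lambda>u. ennreal (indicator A u))) (\<lambda>u. u powr (- h))"
  proof (subst integrable_density)
    show "integrable \<mu> (\<lambda>u. indicator A u *\<^sub>R u powr (- h))"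
    proof (rule Bochner_Integration.integrable_bound)
      show "integrable \<mu> (\<lambda>u. C * u powr (- g))" using \<mu>'(3) by simp
      show "AE u in \<mu>. norm (indicator A u *\<^sub>R u powr (- h)) \<le> norm (C * u powr (- g))"
        using \<mu>'(2)
      proof eventually_elim
        case (elim u)
        then show ?case
          using order_trans[OF h[of u] abs_ge_self[of "C * u powr (- g)"]] by (cases "u \<in> A") auto
      qed
    qed measurable
  qed auto
  ultimately show ?thesis using \<open>sets \<mu> = sets borel\<close> by (simp add: admissible_def ennreal_indicator)
qed

lemma integral_convolution:
  fixes f :: "real \<Rightarrow> real"
  assumes M: "finite_measure M" and N: "finite_measure N"
    and sets [measurable_cong]: "sets M = sets borel" "sets N = sets borel"
    and f: "integrable (M \<star> N) f"
  shows "(LINT z|(M \<star> N). f z) = (LINT x|M. LINT y|N. f (x + y))"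
proof -
  interpret M: finite_measure M by fact
  interpret N: finite_measure N by fact
  interpret pair_sigma_finite M N ..
  have [measurable]: "f \<in> borel_measurable borel" using f by auto
  have int: "integrable (M \<Otimes>\<^sub>M N) (\<lambda>z. f (fst z + snd z))"
    using f by (subst (asm) convolution_def, subst (asm) integrable_distr_eq) (auto simp: split_beta')
  have "(LINT z|(M \<star> N). f z) = (LINT z|(M \<Otimes>\<^sub>M N). f (fst z + snd z))"
    unfolding convolution_def by (subst integral_distr) (auto simp: split_beta')
  also have "\<dots> = (LINT x|M. LINT y|N. f (x + y))"
    using integral_fst'[OF int] by simp
  finally show ?thesis .
qed

lemma boundary_kernel_integrable:
  assumes \<mu>: "admissible g \<mu>" and t: "0 \<le> t" and x: "0 < x"
  shows "integrable \<mu> (\<lambda>u. boundary_kernel (t + u) x)"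
proof -
  have \<mu>': "finite_measure \<mu>" "AE u in \<mu>. 0 < u"
    and [measurable_cong]: "sets \<mu> = sets borel"
    using \<mu> by (auto simp: admissible_def)
  interpret finite_measure \<mu> by fact
  show ?thesis
  proof (rule integrable_const_bound)
    show "AE u in \<mu>. norm (boundary_kernel (t + u) x) \<le> 8 / x\<^sup>2"
      using \<mu>'(2) by eventually_elim (use t x in \<open>auto simp: boundary_kernel_nonneg intro!: boundary_kernel_le\<close>)
  qed measurable
qed

text \<open>
  Fubini's theorem reduces this to the semigroup law up to the boundary; as both kernels are
  nonnegative, that law also yields the absolute convergence it needs.
\<close>

lemma dirichlet_heat_boundary_average:
  assumes \<mu>: "admissible g \<mu>" and t: "0 < t" and x: "0 < x"
  shows "dirichlet_heat t (\<lambda>y. LINT u|\<mu>. boundary_kernel u y) x = (LINT u|\<mu>. boundary_kernel (t + u) x)"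
proof -
  have \<mu>': "finite_measure \<mu>" "AE u in \<mu>. 0 < u"
    and [measurable_cong]: "sets \<mu> = sets borel"
    using \<mu> by (auto simp: admissible_def)
  interpret \<mu>: finite_measure \<mu> by fact
  interpret H: sigma_finite_measure half_line by (rule sigma_finite_half_line)
  interpret pair_sigma_finite \<mu> half_line ..
  have meas_snd [measurable]: "snd \<in> \<mu> \<Otimes>\<^sub>M half_line \<rightarrow>\<^sub>M borel"
    by (rule measurable_compose[OF measurable_snd half_line_measurable]) measurable
  have [measurable]: "fst \<in> \<mu> \<Otimes>\<^sub>M half_line \<rightarrow>\<^sub>M borel"
    by (rule measurable_compose[OF measurable_fst]) measurable
  let ?f = "\<lambda>(u, y). heat_kernel t x y * boundary_kernel u y"
  have f_meas [measurable]: "?f \<in> borel_measurable (\<mu> \<Otimes>\<^sub>M half_line)"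
    unfolding heat_kernel_def split_beta' by measurable
  have int_y: "integrable half_line (\<lambda>y. heat_kernel t x y * boundary_kernel u y)"
    "(LINT y|half_line. heat_kernel t x y * boundary_kernel u y) = boundary_kernel (t + u) x" if "0 < u" for u
    using heat_kernel_boundary_kernel[OF t that, of x] by (auto simp: has_bochner_integral_iff)
  have abs_y: "(LINT y|half_line. \<bar>heat_kernel t x y * boundary_kernel u y\<bar>) = boundary_kernel (t + u) x" if "0 < u" for u
    unfolding int_y(2)[OF that, symmetric]
    by (intro Bochner_Integration.integral_cong) (use t x in \<open>auto simp: heat_kernel_nonneg boundary_kernel_nonneg\<close>)
  have int: "integrable (\<mu> \<Otimes>\<^sub>M half_line) ?f"
  proof (rule Fubini_integrable)
    show "integrable \<mu> (\<lambda>u. LINT y|half_line. norm (case (u, y) of (u, y) \<Rightarrow> heat_kernel t x y * boundary_kernel u y))"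
    proof (rule integrable_cong_AE_imp)
      show "integrable \<mu> (\<lambda>u. boundary_kernel (t + u) x)"
        using boundary_kernel_integrable[OF \<mu> _ x] t by simp
      show "AE u in \<mu>. boundary_kernel (t + u) x =
          (LINT y|half_line. norm (case (u, y) of (u, y) \<Rightarrow> heat_kernel t x y * boundary_kernel u y))"
        using \<mu>'(2) by eventually_elim (simp add: abs_y)
    qed measurable
    show "AE u in \<mu>. integrable half_line (\<lambda>y. case (u, y) of (u, y) \<Rightarrow> heat_kernel t x y * boundary_kernel u y)"
      using \<mu>'(2) by eventually_elim (simp add: int_y)
  qed measurable
  have "dirichlet_heat t (\<lambda>y. LINT u|\<mu>. boundary_kernel u y) x =
      (LINT y|half_line. LINT u|\<mu>. heat_kernel t x y * boundary_kernel u y)"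
    by (simp add: dirichlet_heat_def)
  also have "\<dots> = (LINT u|\<mu>. LINT y|half_line. heat_kernel t x y * boundary_kernel u y)"
    using Fubini_integral[OF int] by simp
  also have "\<dots> = (LINT u|\<mu>. boundary_kernel (t + u) x)"
    using \<mu>'(2) by (intro integral_cong_AE) (auto elim!: eventually_mono simp: int_y)
  finally show ?thesis .
qed

section \<open>Bounded strongly continuous semigroups and fractional powers\<close>

lemma L2_semigroup_in:
  "C0_semigroup M S \<Longrightarrow> 0 \<le> t \<Longrightarrow> f \<in> L2 M \<Longrightarrow> S t f \<in> L2 M"
  by (simp add: C0_semigroup_def L2_bounded_linear_def)

lemma semigroup_lincomb:
  "C0_semigroup M S \<Longrightarrow> 0 \<le> t \<Longrightarrow> f \<in> L2 M \<Longrightarrow> g \<in> L2 M \<Longrightarrow>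
    AE x in M. S t (\<lambda>y. a * f y + b * g y) x = a * S t f x + b * S t g x"
  by (simp add: C0_semigroup_def L2_bounded_linear_def)

lemma semigroup_inner_lincomb:
  assumes S: "C0_semigroup M S" and t: "0 \<le> t" and f: "f \<in> L2 M" "g \<in> L2 M" and v: "v \<in> L2 M"
  shows "L2_inner M (S t (\<lambda>y. a * f y + b * g y)) v = a * L2_inner M (S t f) v + b * L2_inner M (S t g) v"
proof -
  have "L2_inner M (S t (\<lambda>y. a * f y + b * g y)) v = L2_inner M (\<lambda>x. a * S t f x + b * S t g x) v"
    using assms by (intro L2_inner_cong_AE L2_semigroup_in[OF S t] L2_lincomb semigroup_lincomb) auto
  also have "\<dots> = a * L2_inner M (S t f) v + b * L2_inner M (S t g) v"
    using assms by (intro L2_inner_lincomb L2_semigroup_in[OF S t])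
  finally show ?thesis .
qed

lemma bounded_semigroup_bound:
  assumes "bounded_semigroup M S"
  shows "\<exists>K\<ge>0. \<forall>t f. 0 \<le> t \<longrightarrow> f \<in> L2 M \<longrightarrow> L2_norm M (S t f) \<le> K * L2_norm M f"
proof -
  from assms obtain K where K: "\<forall>t\<ge>0. \<forall>f\<in>L2 M. L2_norm M (S t f) \<le> K * L2_norm M f"
    unfolding bounded_semigroup_def by blast
  have "L2_norm M (S t f) \<le> max K 0 * L2_norm M f" if "0 \<le> t" "f \<in> L2 M" for t f
  proof -
    have "L2_norm M (S t f) \<le> K * L2_norm M f" using K that by blast
    also have "\<dots> \<le> max K 0 * L2_norm M f" by (intro mult_right_mono) auto
    finally show ?thesis .
  qed
  then show ?thesis by (intro exI[of _ "max K 0"]) auto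
qed

lemma semigroup_diff_le:
  assumes S: "C0_semigroup M S"
    and K: "\<And>t f. 0 \<le> t \<Longrightarrow> f \<in> L2 M \<Longrightarrow> L2_norm M (S t f) \<le> K * L2_norm M f"
    and st: "0 \<le> s" "s \<le> t" and f: "f \<in> L2 M"
  shows "L2_norm M (\<lambda>x. S t f x - S s f x) \<le> K * L2_norm M (\<lambda>x. S (t - s) f x - f x)"
proof -
  define d where "d = (\<lambda>x. S (t - s) f x - f x)"
  have d: "d \<in> L2 M" unfolding d_def using st f by (intro L2_diff L2_semigroup_in[OF S]) auto
  have "AE x in M. S (s + (t - s)) f x = S s (S (t - s) f) x"
    using S st f unfolding C0_semigroup_def by (metis diff_ge_0_iff_ge)
  moreover have "AE x in M. S s d x = S s (S (t - s) f) x - S s f x"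
    using semigroup_lincomb[OF S st(1) L2_semigroup_in[OF S _ f] f, of "t - s" 1 "-1"] st
    by (simp add: d_def)
  ultimately have "AE x in M. S t f x - S s f x = S s d x"
    by eventually_elim simp
  then have "L2_norm M (\<lambda>x. S t f x - S s f x) = L2_norm M (S s d)"
    using st f d by (intro L2_norm_cong_AE L2_diff L2_semigroup_in[OF S]) auto
  also have "\<dots> \<le> K * L2_norm M d" by (rule K) fact+
  finally show ?thesis by (simp add: d_def)
qed

lemma semigroup_norm_continuous:
  assumes S: "C0_semigroup M S" and bdd: "bounded_semigroup M S"
    and f: "f \<in> L2 M" and s: "0 \<le> s"
  shows "((\<lambda>t. L2_norm M (\<lambda>x. S t f x - S s f x)) \<longlongrightarrow> 0) (at s within {0..})"
proof -
  obtain K where "0 \<le> K" and K: "\<And>t f. 0 \<le> t \<Longrightarrow> f \<in> L2 M \<Longrightarrow> L2_norm M (S t f) \<le> K * L2_norm M f"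
    using bounded_semigroup_bound[OF bdd] by blast
  have lim: "((\<lambda>t. L2_norm M (\<lambda>x. S t f x - f x)) \<longlongrightarrow> 0) (at_right 0)"
    using S f by (simp add: C0_semigroup_def)
  have "filterlim (\<lambda>t. \<bar>t - s\<bar>) (at_right 0) (at s within {0..})"
    unfolding filterlim_at by (auto intro!: tendsto_eq_intros simp: eventually_at_filter)
  from filterlim_compose[OF lim this]
  have "((\<lambda>t. K * L2_norm M (\<lambda>x. S \<bar>t - s\<bar> f x - f x)) \<longlongrightarrow> K * 0) (at s within {0..})"
    by (intro tendsto_intros)
  then have "((\<lambda>t. K * L2_norm M (\<lambda>x. S \<bar>t - s\<bar> f x - f x)) \<longlongrightarrow> 0) (at s within {0..})"
    by simp
  then show ?thesis
  proof (rule Lim_null_comparison[rotated])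
    show "\<forall>\<^sub>F t in at s within {0..}. norm (L2_norm M (\<lambda>x. S t f x - S s f x)) \<le> K * L2_norm M (\<lambda>x. S \<bar>t - s\<bar> f x - f x)"
      unfolding eventually_at_filter
    proof (intro always_eventually allI impI)
      fix t :: real
      assume "t \<in> {0..}"
      then have t: "0 \<le> t" by simp
      have swap: "L2_norm M (\<lambda>x. S t f x - S s f x) = L2_norm M (\<lambda>x. S s f x - S t f x)"
        using L2_norm_scale[of M "-1" "\<lambda>x. S s f x - S t f x"] by simp
      show "norm (L2_norm M (\<lambda>x. S t f x - S s f x)) \<le> K * L2_norm M (\<lambda>x. S \<bar>t - s\<bar> f x - f x)"
      proof (cases "s \<le> t")
        case True
        then show ?thesis using semigroup_diff_le[OF S K s _ f, of t] by simp
      next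
        case False
        then show ?thesis using semigroup_diff_le[OF S K t _ f, of s] by (simp add: swap)
      qed
    qed
  qed
qed

lemma semigroup_inner_continuous:
  assumes S: "C0_semigroup M S" and bdd: "bounded_semigroup M S"
    and f: "f \<in> L2 M" and v: "v \<in> L2 M"
  shows "continuous_on {0..} (\<lambda>t. L2_inner M (S t f) v)"
  unfolding continuous_on_def
proof (intro ballI)
  fix s :: real
  assume "s \<in> {0..}"
  then have s: "0 \<le> s" by simp
  have "((\<lambda>t. L2_inner M (S t f) v - L2_inner M (S s f) v) \<longlongrightarrow> 0) (at s within {0..})"
  proof (rule Lim_null_comparison)
    show "((\<lambda>t. L2_norm M (\<lambda>x. S t f x - S s f x) * L2_norm M v) \<longlongrightarrow> 0) (at s within {0..})"
      using semigroup_norm_continuous[OF S bdd f s] by (rule tendsto_mult_left_zero)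
    show "\<forall>\<^sub>F t in at s within {0..}. norm (L2_inner M (S t f) v - L2_inner M (S s f) v)
        \<le> L2_norm M (\<lambda>x. S t f x - S s f x) * L2_norm M v"
      unfolding eventually_at_filter
    proof (intro always_eventually allI impI)
      fix t :: real
      assume "t \<in> {0..}"
      then have t: "0 \<le> t" by simp
      note St = L2_semigroup_in[OF S t f] and Ss = L2_semigroup_in[OF S s f]
      show "norm (L2_inner M (S t f) v - L2_inner M (S s f) v) \<le> L2_norm M (\<lambda>x. S t f x - S s f x) * L2_norm M v"
        using L2_Cauchy_Schwarz[OF L2_diff[OF St Ss] v] L2_inner_diff[OF St Ss v] by simp
    qed
  qed
  then show "((\<lambda>t. L2_inner M (S t f) v) \<longlongrightarrow> L2_inner M (S s f) v) (at s within {0..})"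
    by (simp add: LIM_zero_iff)
qed

lemma semigroup_norm_continuous_on:
  assumes S: "C0_semigroup M S" and bdd: "bounded_semigroup M S" and f: "f \<in> L2 M"
  shows "continuous_on {0..} (\<lambda>t. L2_norm M (S t f))"
  unfolding continuous_on_def
proof (intro ballI)
  fix s :: real
  assume "s \<in> {0..}"
  then have s: "0 \<le> s" by simp
  have "((\<lambda>t. L2_norm M (S t f) - L2_norm M (S s f)) \<longlongrightarrow> 0) (at s within {0..})"
  proof (rule Lim_null_comparison)
    show "((\<lambda>t. L2_norm M (\<lambda>x. S t f x - S s f x)) \<longlongrightarrow> 0) (at s within {0..})"
      by (rule semigroup_norm_continuous[OF S bdd f s])
    show "\<forall>\<^sub>F t in at s within {0..}. norm (L2_norm M (S t f) - L2_norm M (S s f)) \<le> L2_norm M (\<lambda>x. S t f x - S s f x)"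
      unfolding eventually_at_filter
      using L2_norm_diff_abs[OF L2_semigroup_in[OF S _ f] L2_semigroup_in[OF S s f]] by auto
  qed
  then show "((\<lambda>t. L2_norm M (S t f)) \<longlongrightarrow> L2_norm M (S s f)) (at s within {0..})"
    by (simp add: LIM_zero_iff)
qed

lemma integrable_gamma_measure_bounded:
  fixes h :: "real \<Rightarrow> real"
  assumes a: "0 < a" and r: "0 < r" and [measurable]: "h \<in> borel_measurable borel"
    and B: "\<And>t. \<bar>h t\<bar> \<le> B"
  shows "integrable (gamma_measure a r) h"
    and "set_integrable lborel {0<..} (\<lambda>t. t powr (a - 1) / Gamma a * exp (- r * t) * h t)"
    and "(LINT t:{0<..}|lborel. t powr (a - 1) / Gamma a * exp (- r * t) * h t) = (LINT t|gamma_measure a r. h t)"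
proof -
  interpret finite_measure "gamma_measure a r" using a r by (rule finite_gamma_measure)
  have eq: "indicator {0<..} t *\<^sub>R (t powr (a - 1) / Gamma a * exp (- r * t) * h t) = gamma_density a r t *\<^sub>R h t" for t
    by (simp add: gamma_density_def)
  show int: "integrable (gamma_measure a r) h"
    using B by (intro integrable_const_bound[where B=B]) auto
  then show "set_integrable lborel {0<..} (\<lambda>t. t powr (a - 1) / Gamma a * exp (- r * t) * h t)"
    unfolding set_integrable_def eq gamma_measure_def
    using a by (subst (asm) integrable_density) (auto simp: gamma_density_nonneg)
  show "(LINT t:{0<..}|lborel. t powr (a - 1) / Gamma a * exp (- r * t) * h t) = (LINT t|gamma_measure a r. h t)"
    unfolding set_lebesgue_integral_def eq gamma_measure_def
    using a by (intro integral_density[symmetric]) (auto simp: gamma_density_nonneg)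
qed

text \<open>
  A semigroup is arbitrary, possibly not even measurable, at negative times. Measures on the positive
  half line do not see them, and writing \<open>\<bar>t\<bar>\<close> makes the functions measurable on the whole line.
\<close>

lemma semigroup_inner_measurable:
  assumes "C0_semigroup M S" "bounded_semigroup M S" "f \<in> L2 M" "v \<in> L2 M"
  shows "(\<lambda>t. L2_inner M (S \<bar>t\<bar> f) v) \<in> borel_measurable borel"
  by (intro borel_measurable_continuous_onI continuous_on_compose2[OF semigroup_inner_continuous[OF assms]] continuous_intros) auto

lemma semigroup_norm_measurable:
  assumes "C0_semigroup M S" "bounded_semigroup M S" "f \<in> L2 M"
  shows "(\<lambda>t. L2_norm M (S \<bar>t\<bar> f)) \<in> borel_measurable borel"
  by (intro borel_measurable_continuous_onI continuous_on_compose2[OF semigroup_norm_continuous_on[OF assms]] continuous_intros) auto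

lemma semigroup_inner_bounded:
  assumes S: "C0_semigroup M S" and bdd: "bounded_semigroup M S" and f: "f \<in> L2 M" and v: "v \<in> L2 M"
  shows "\<exists>B. \<forall>t. \<bar>L2_inner M (S \<bar>t\<bar> f) v\<bar> \<le> B"
proof -
  obtain K where "0 \<le> K" and K: "\<And>t f. 0 \<le> t \<Longrightarrow> f \<in> L2 M \<Longrightarrow> L2_norm M (S t f) \<le> K * L2_norm M f"
    using bounded_semigroup_bound[OF bdd] by blast
  have "\<bar>L2_inner M (S \<bar>t\<bar> f) v\<bar> \<le> K * L2_norm M f * L2_norm M v" for t
    using L2_Cauchy_Schwarz[OF L2_semigroup_in[OF S abs_ge_zero f] v, of t]
      mult_right_mono[OF K[OF abs_ge_zero f, of t] L2_norm_nonneg[of M v]] by linarith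
  then show ?thesis by blast
qed

lemma semigroup_inner_integrable:
  assumes S: "C0_semigroup M S" and bdd: "bounded_semigroup M S"
    and a: "0 < a" and r: "0 < r" and f: "f \<in> L2 M" and v: "v \<in> L2 M"
  shows "integrable (gamma_measure a r) (\<lambda>t. L2_inner M (S \<bar>t\<bar> f) v)"
proof -
  obtain B where "\<And>t. \<bar>L2_inner M (S \<bar>t\<bar> f) v\<bar> \<le> B"
    using semigroup_inner_bounded[OF S bdd f v] by blast
  then show ?thesis
    by (rule integrable_gamma_measure_bounded(1)[OF a r semigroup_inner_measurable[OF S bdd f v]])
qed

definition damped :: "real \<Rightarrow> (real \<Rightarrow> ('a \<Rightarrow> real) \<Rightarrow> ('a \<Rightarrow> real)) \<Rightarrow> real \<Rightarrow> ('a \<Rightarrow> real) \<Rightarrow> 'a \<Rightarrow> real" where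
  "damped r S t f = (\<lambda>x. exp (- r * t) * S t f x)"

lemma damped_C0_semigroup:
  assumes S: "C0_semigroup M S"
  shows "C0_semigroup M (damped r S)"
  unfolding C0_semigroup_def
proof (intro conjI allI impI ballI)
  fix t :: real
  assume t: "0 \<le> t"
  show "L2_bounded_linear M (damped r S t)"
    unfolding L2_bounded_linear_def
  proof (intro conjI ballI allI)
    show "damped r S t f \<in> L2 M" if "f \<in> L2 M" for f
      unfolding damped_def using L2_semigroup_in[OF S t that] by (rule L2_scale)
    show "AE x in M. damped r S t (\<lambda>y. a * f y + b * g y) x = a * damped r S t f x + b * damped r S t g x"
      if "f \<in> L2 M" "g \<in> L2 M" for f g a b
      using semigroup_lincomb[OF S t that, of a b]
      by eventually_elim (simp add: damped_def algebra_simps)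
    obtain K where K: "\<forall>f\<in>L2 M. L2_norm M (S t f) \<le> K * L2_norm M f"
      using S t by (auto simp: C0_semigroup_def L2_bounded_linear_def)
    show "\<exists>K. \<forall>f\<in>L2 M. L2_norm M (damped r S t f) \<le> K * L2_norm M f"
    proof (intro exI[of _ "exp (- r * t) * K"] ballI)
      show "L2_norm M (damped r S t f) \<le> exp (- r * t) * K * L2_norm M f" if "f \<in> L2 M" for f
        using K that by (simp add: damped_def L2_norm_scale)
    qed
  qed
next
  fix f
  assume f: "f \<in> L2 M"
  have "AE x in M. S 0 f x = f x" using S f by (simp add: C0_semigroup_def)
  then show "AE x in M. damped r S 0 f x = f x"
    by eventually_elim (simp add: damped_def)
next
  fix s t :: real and f
  assume s: "0 \<le> s" and t: "0 \<le> t" and f: "f \<in> L2 M"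
  have "AE x in M. S (s + t) f x = S s (S t f) x"
    using S s t f by (simp add: C0_semigroup_def)
  moreover have "AE x in M. S s (damped r S t f) x = exp (- r * t) * S s (S t f) x"
    using semigroup_lincomb[OF S s L2_semigroup_in[OF S t f] L2_semigroup_in[OF S t f], of "exp (- r * t)" 0]
    by (simp add: damped_def)
  ultimately show "AE x in M. damped r S (s + t) f x = damped r S s (damped r S t f) x"
    by eventually_elim (simp add: damped_def algebra_simps exp_add[symmetric])
next
  fix f
  assume f: "f \<in> L2 M"
  have lim: "((\<lambda>t. L2_norm M (\<lambda>x. S t f x - f x)) \<longlongrightarrow> 0) (at_right 0)"
    using S f by (simp add: C0_semigroup_def)
  have "((\<lambda>t. exp (- r * t) * L2_norm M (\<lambda>x. S t f x - f x) + \<bar>exp (- r * t) - 1\<bar> * L2_norm M f) \<longlongrightarrow>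
      exp (- r * 0) * 0 + \<bar>exp (- r * 0) - 1\<bar> * L2_norm M f) (at_right 0)"
    by (intro tendsto_intros lim)
  then have bound: "((\<lambda>t. exp (- r * t) * L2_norm M (\<lambda>x. S t f x - f x) + \<bar>exp (- r * t) - 1\<bar> * L2_norm M f) \<longlongrightarrow> 0) (at_right 0)"
    by simp
  show "((\<lambda>t. L2_norm M (\<lambda>x. damped r S t f x - f x)) \<longlongrightarrow> 0) (at_right 0)"
  proof (rule Lim_null_comparison[OF _ bound])
    show "\<forall>\<^sub>F t in at_right 0. norm (L2_norm M (\<lambda>x. damped r S t f x - f x)) \<le>
        exp (- r * t) * L2_norm M (\<lambda>x. S t f x - f x) + \<bar>exp (- r * t) - 1\<bar> * L2_norm M f"
      unfolding eventually_at_filter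
    proof (intro always_eventually allI impI)
      fix t :: real
      assume "t \<in> {0<..}"
      then have t: "0 \<le> t" by simp
      have "(\<lambda>x. damped r S t f x - f x) = (\<lambda>x. exp (- r * t) * (S t f x - f x) + (exp (- r * t) - 1) * f x)"
        by (simp add: damped_def algebra_simps)
      then show "norm (L2_norm M (\<lambda>x. damped r S t f x - f x)) \<le>
        exp (- r * t) * L2_norm M (\<lambda>x. S t f x - f x) + \<bar>exp (- r * t) - 1\<bar> * L2_norm M f"
        using L2_norm_triangle[OF L2_scale[OF L2_diff[OF L2_semigroup_in[OF S t f] f], of "exp (- r * t)"]
            L2_scale[OF f, of "exp (- r * t) - 1"]]
        by (simp add: L2_norm_scale)
    qed
  qed
qed

lemma damped_exp_stable:
  assumes bdd: "bounded_semigroup M S" and r: "0 < r"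
  shows "exp_stable M (damped r S)"
proof -
  obtain K where "0 \<le> K" and K: "\<And>t f. 0 \<le> t \<Longrightarrow> f \<in> L2 M \<Longrightarrow> L2_norm M (S t f) \<le> K * L2_norm M f"
    using bounded_semigroup_bound[OF bdd] by blast
  show ?thesis
    unfolding exp_stable_def
  proof (rule exI[of _ K], rule exI[of _ r], intro conjI allI impI ballI)
    fix t :: real and f
    assume "0 \<le> t" "f \<in> L2 M"
    then have "exp (- r * t) * L2_norm M (S t f) \<le> exp (- r * t) * (K * L2_norm M f)"
      by (intro mult_left_mono K) auto
    also have "exp (- r * t) * L2_norm M (S t f) = L2_norm M (damped r S t f)"
      by (simp add: damped_def L2_norm_scale)
    finally show "L2_norm M (damped r S t f) \<le> K * exp (- r * t) * L2_norm M f"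
      by (simp only: mult.left_commute mult.assoc)
  qed fact
qed

text \<open>
  The two functions under the norms differ by
  \<open>((exp (- r * h) - 1) / h + r) * S h f - r * (S h f - f)\<close>, which tends to \<open>0\<close> in norm.
\<close>

lemma damped_difference_quotient:
  assumes S: "C0_semigroup M S" and bdd: "bounded_semigroup M S" and f: "f \<in> L2 M" and g: "g \<in> L2 M"
  shows "((\<lambda>h. L2_norm M (\<lambda>x. (damped r S h f x - f x) / h - g x)) \<longlongrightarrow> 0) (at_right 0) \<longleftrightarrow>
    ((\<lambda>h. L2_norm M (\<lambda>x. (S h f x - f x) / h - (g x + r * f x))) \<longlongrightarrow> 0) (at_right 0)"
    (is "(?P \<longlongrightarrow> 0) _ \<longleftrightarrow> (?Q \<longlongrightarrow> 0) _")
proof -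
  obtain K where "0 \<le> K" and K: "\<And>t f. 0 \<le> t \<Longrightarrow> f \<in> L2 M \<Longrightarrow> L2_norm M (S t f) \<le> K * L2_norm M f"
    using bounded_semigroup_bound[OF bdd] by blast
  have lim: "((\<lambda>t. L2_norm M (\<lambda>x. S t f x - f x)) \<longlongrightarrow> 0) (at_right 0)"
    using S f by (simp add: C0_semigroup_def)
  have "((\<lambda>h. (exp (- r * h) - 1) / h + r) \<longlongrightarrow> 0) (at_right 0)"
  proof -
    have "((\<lambda>h. exp (- r * h)) has_real_derivative - r) (at 0)"
      by (auto intro!: derivative_eq_intros)
    then have "((\<lambda>h. (exp (- r * h) - 1) / h) \<longlongrightarrow> - r) (at 0)"
      using DERIV_D[where f="\<lambda>h. exp (- r * h)" and x=0 and D="- r"] by simp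
    then have "((\<lambda>h. (exp (- r * h) - 1) / h + r) \<longlongrightarrow> - r + r) (at 0)"
      by (intro tendsto_intros)
    then show ?thesis by (simp add: filterlim_at_split)
  qed
  then have "((\<lambda>h. \<bar>(exp (- r * h) - 1) / h + r\<bar> * (K * L2_norm M f) + \<bar>r\<bar> * L2_norm M (\<lambda>x. S h f x - f x))
      \<longlongrightarrow> \<bar>0\<bar> * (K * L2_norm M f) + \<bar>r\<bar> * 0) (at_right 0)"
    by (intro tendsto_intros lim)
  then have bound: "((\<lambda>h. \<bar>(exp (- r * h) - 1) / h + r\<bar> * (K * L2_norm M f) + \<bar>r\<bar> * L2_norm M (\<lambda>x. S h f x - f x))
      \<longlongrightarrow> 0) (at_right 0)" by simp
  have "((\<lambda>h. ?P h - ?Q h) \<longlongrightarrow> 0) (at_right 0)"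
  proof (rule Lim_null_comparison[OF _ bound])
    show "\<forall>\<^sub>F h in at_right 0. norm (?P h - ?Q h) \<le>
        \<bar>(exp (- r * h) - 1) / h + r\<bar> * (K * L2_norm M f) + \<bar>r\<bar> * L2_norm M (\<lambda>x. S h f x - f x)"
      unfolding eventually_at_filter
    proof (intro always_eventually allI impI)
      fix h :: real
      assume "h \<in> {0<..}"
      then have h: "0 < h" "0 \<le> h" by auto
      note Sh = L2_semigroup_in[OF S h(2) f]
      let ?c = "(exp (- r * h) - 1) / h + r"
      have P: "(\<lambda>x. (damped r S h f x - f x) / h - g x) \<in> L2 M"
      proof -
        have "(\<lambda>x. 1 / h * (exp (- r * h) * S h f x - f x) - g x) \<in> L2 M"
          by (intro L2_diff L2_scale Sh f g)
        then show ?thesis by (simp add: damped_def)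
      qed
      have Q: "(\<lambda>x. (S h f x - f x) / h - (g x + r * f x)) \<in> L2 M"
      proof -
        have "(\<lambda>x. 1 / h * (S h f x - f x) - (g x + r * f x)) \<in> L2 M"
          by (intro L2_diff L2_scale L2_add Sh f g)
        then show ?thesis by simp
      qed
      have "norm (?P h - ?Q h) \<le> L2_norm M (\<lambda>x. ((damped r S h f x - f x) / h - g x) - ((S h f x - f x) / h - (g x + r * f x)))"
        using L2_norm_diff_abs[OF P Q] by simp
      also have "(\<lambda>x. ((damped r S h f x - f x) / h - g x) - ((S h f x - f x) / h - (g x + r * f x))) =
          (\<lambda>x. ?c * S h f x + (- r) * (S h f x - f x))"
        using h by (auto simp: damped_def field_simps)
      also have "L2_norm M (\<lambda>x. ?c * S h f x + (- r) * (S h f x - f x)) \<le>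
          L2_norm M (\<lambda>x. ?c * S h f x) + L2_norm M (\<lambda>x. (- r) * (S h f x - f x))"
        by (intro L2_norm_triangle L2_scale L2_diff Sh f)
      also have "\<dots> = \<bar>?c\<bar> * L2_norm M (S h f) + \<bar>r\<bar> * L2_norm M (\<lambda>x. S h f x - f x)"
        by (simp only: L2_norm_scale abs_minus_cancel)
      also have "\<dots> \<le> \<bar>?c\<bar> * (K * L2_norm M f) + \<bar>r\<bar> * L2_norm M (\<lambda>x. S h f x - f x)"
        by (intro add_mono mult_left_mono K h f) auto
      finally show "norm (?P h - ?Q h) \<le> \<bar>?c\<bar> * (K * L2_norm M f) + \<bar>r\<bar> * L2_norm M (\<lambda>x. S h f x - f x)" .
    qed
  qed
  then show ?thesis
    using tendsto_add[of "\<lambda>h. ?P h - ?Q h" 0 "at_right 0" ?Q 0] tendsto_diff[of ?P 0 "at_right 0" "\<lambda>h. ?P h - ?Q h" 0]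
    by auto
qed

lemma shiftedI: "(f, g) \<in> B \<Longrightarrow> (f, \<lambda>x. r * f x - g x) \<in> shifted r B"
  unfolding shifted_def by (rule CollectI, intro exI conjI, rule refl)

lemma op_negI: "(f, g) \<in> B \<Longrightarrow> (f, \<lambda>x. - g x) \<in> op_neg B"
  unfolding op_neg_def by (rule CollectI, intro exI conjI, rule refl)

lemma damped_generator:
  assumes S: "C0_semigroup M S" and bdd: "bounded_semigroup M S"
  shows "generator M (damped r S) = op_neg (shifted r (generator M S))"
proof (intro set_eqI iffI)
  fix p
  assume "p \<in> generator M (damped r S)"
  then obtain f g where p: "p = (f, g)" and f: "f \<in> L2 M" and g: "g \<in> L2 M"
    and lim: "((\<lambda>h. L2_norm M (\<lambda>x. (damped r S h f x - f x) / h - g x)) \<longlongrightarrow> 0) (at_right 0)"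
    by (auto simp: generator_def)
  have "(f, \<lambda>x. g x + r * f x) \<in> generator M S"
    using lim f g damped_difference_quotient[OF S bdd f g, of r] by (auto simp: generator_def intro: L2_add L2_scale)
  then have "(f, \<lambda>x. r * f x - (g x + r * f x)) \<in> shifted r (generator M S)"
    by (rule shiftedI)
  then have "(f, \<lambda>x. - (r * f x - (g x + r * f x))) \<in> op_neg (shifted r (generator M S))"
    by (rule op_negI)
  then show "p \<in> op_neg (shifted r (generator M S))" by (simp add: p)
next
  fix p
  assume "p \<in> op_neg (shifted r (generator M S))"
  then obtain f g where p: "p = (f, \<lambda>x. - (r * f x - g x))" and "(f, g) \<in> generator M S"
    by (auto simp: op_neg_def shifted_def)
  then have f: "f \<in> L2 M" and g: "g \<in> L2 M"
    and lim: "((\<lambda>h. L2_norm M (\<lambda>x. (S h f x - f x) / h - g x)) \<longlongrightarrow> 0) (at_right 0)"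
    by (auto simp: generator_def)
  have g': "(\<lambda>x. - (r * f x - g x)) \<in> L2 M"
    using L2_lincomb[OF f g, of "- r" 1] by simp
  show "p \<in> generator M (damped r S)"
    using lim f g' damped_difference_quotient[OF S bdd f g', of r] by (auto simp: p generator_def)
qed

text \<open>
  The damped semigroup has generator \<open>- (r - A)\<close> and is exponentially stable, so that it witnesses
  membership in the fractional power of \<open>r - A\<close>. Its weak integral against \<open>t powr (a - 1) / Gamma a\<close>
  is an integral of the semigroup itself against a gamma measure.
\<close>

lemma frac_power_memI:
  assumes S: "C0_semigroup M S" and bdd: "bounded_semigroup M S"
    and a: "0 < a" and r: "0 < r" and f: "f \<in> L2 M" and g: "g \<in> L2 M"
    and eq: "\<And>v. v \<in> L2 M \<Longrightarrow> (LINT t|gamma_measure a r. L2_inner M (S \<bar>t\<bar> g) v) = L2_inner M f v"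
  shows "(f, g) \<in> frac_power M (shifted r (generator M S)) a"
proof -
  obtain K where "0 \<le> K" and K: "\<And>t f. 0 \<le> t \<Longrightarrow> f \<in> L2 M \<Longrightarrow> L2_norm M (S t f) \<le> K * L2_norm M f"
    using bounded_semigroup_bound[OF bdd] by blast
  let ?F = "\<lambda>t x. t powr (a - 1) / Gamma a * damped r S t g x"
  have F: "?F t = (\<lambda>x. t powr (a - 1) / Gamma a * exp (- r * t) * S t g x)" for t
    by (simp add: damped_def mult.assoc)
  have "L2_has_integral M ?F f"
    unfolding L2_has_integral_def
  proof (intro conjI allI impI ballI)
    show "?F t \<in> L2 M" if "0 < t" for t
      unfolding F using that by (intro L2_scale L2_semigroup_in[OF S _ g]) simp
    have "set_integrable lborel {0<..} (\<lambda>t. t powr (a - 1) / Gamma a * exp (- r * t) * L2_norm M (S \<bar>t\<bar> g))"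
      using K[OF abs_ge_zero g] by (intro integrable_gamma_measure_bounded(2) a r semigroup_norm_measurable[OF S bdd g]) simp
    also have "?this \<longleftrightarrow> set_integrable lborel {0<..} (\<lambda>t. L2_norm M (?F t))"
      unfolding F L2_norm_scale using a
      by (intro set_integrable_cong refl) (simp add: abs_mult Gamma_real_nonneg)
    finally show "set_integrable lborel {0<..} (\<lambda>t. L2_norm M (?F t))" .
    fix v
    assume v: "v \<in> L2 M"
    obtain B where B: "\<And>t. \<bar>L2_inner M (S \<bar>t\<bar> g) v\<bar> \<le> B"
      using semigroup_inner_bounded[OF S bdd g v] by blast
    note int = integrable_gamma_measure_bounded[OF a r semigroup_inner_measurable[OF S bdd g v] B]
    have cong: "t powr (a - 1) / Gamma a * exp (- r * t) * L2_inner M (S \<bar>t\<bar> g) v = L2_inner M (?F t) v"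
      if "t \<in> {0<..}" for t
      unfolding F L2_inner_scale using that by simp
    show "set_integrable lborel {0<..} (\<lambda>t. L2_inner M (?F t) v)"
      using int(2) by (rule back_subst[of "\<lambda>b. b"]) (intro set_integrable_cong refl cong)
    have "(LINT t:{0<..}|lborel. L2_inner M (?F t) v) =
        (LINT t:{0<..}|lborel. t powr (a - 1) / Gamma a * exp (- r * t) * L2_inner M (S \<bar>t\<bar> g) v)"
      by (intro set_lebesgue_integral_cong allI impI cong[symmetric]) auto
    then show "(LINT t:{0<..}|lborel. L2_inner M (?F t) v) = L2_inner M f v"
      by (simp only: int(3) eq[OF v])
  qed (fact f)
  moreover have "C0_semigroup M (damped r S)" "exp_stable M (damped r S)"
    "generator M (damped r S) = op_neg (shifted r (generator M S))"
    using damped_C0_semigroup[OF S] damped_exp_stable[OF bdd r] damped_generator[OF S bdd] by auto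
  ultimately show ?thesis
    unfolding frac_power_def using a f g by auto
qed

section \<open>The extended heat semigroup on averages of the boundary kernel\<close>

text \<open>
  Common ground for the spaces in play: \<open>q = \<theta>\<close> covers both weights of the theorem, and \<open>q = -1\<close>
  the unweighted space.
\<close>

locale boundary_weight =
  fixes \<rho> :: "real \<Rightarrow> real" and q :: real
  assumes weight_measurable [measurable]: "\<rho> \<in> borel_measurable borel"
    and exponent_bounds: "-1 \<le> q" "q \<le> 1"
    and weight_le: "0 < x \<Longrightarrow> 0 \<le> \<rho> x \<and> \<rho> x \<le> x powr (1 + q)"
begin

lemma kernel_average:
  assumes \<mu>: "admissible (1/2 - q/4) \<mu>" and t: "0 \<le> t"
  shows "L2_kernel_average (weighted \<rho>) \<mu> (\<lambda>u. boundary_kernel (t + u)) (\<lambda>u. 2 * u powr (- (1/2 - q/4)))"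
proof -
  have \<mu>': "finite_measure \<mu>" "AE u in \<mu>. 0 < u" "integrable \<mu> (\<lambda>u. u powr (- (1/2 - q/4)))"
    and [measurable_cong]: "sets \<mu> = sets borel"
    using \<mu> by (auto simp: admissible_def)
  interpret \<mu>: finite_measure \<mu> by fact
  interpret H: sigma_finite_measure "weighted \<rho>" by (rule sigma_finite_weighted) measurable
  have [measurable]: "snd \<in> \<mu> \<Otimes>\<^sub>M weighted \<rho> \<rightarrow>\<^sub>M borel"
    by (rule measurable_compose[OF measurable_snd weighted_measurable]) measurable
  have [measurable]: "fst \<in> \<mu> \<Otimes>\<^sub>M weighted \<rho> \<rightarrow>\<^sub>M borel"
    by (rule measurable_compose[OF measurable_fst]) measurable
  note L2 = boundary_kernel_L2[OF _ exponent_bounds weight_measurable weight_le]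
  show ?thesis
  proof
    show "(\<lambda>(u, x). boundary_kernel (t + u) x) \<in> borel_measurable (\<mu> \<Otimes>\<^sub>M weighted \<rho>)"
      unfolding split_beta' by measurable
    show "integrable \<mu> (\<lambda>u. 2 * u powr (- (1/2 - q/4)))" using \<mu>'(3) by simp
    show "AE u in \<mu>. 0 < 2 * u powr (- (1/2 - q/4))"
      using \<mu>'(2) by eventually_elim simp
    show "AE u in \<mu>. boundary_kernel (t + u) \<in> L2 (weighted \<rho>)"
      using \<mu>'(2) by eventually_elim (use t in \<open>auto intro!: L2(1)\<close>)
    show "AE u in \<mu>. L2_norm (weighted \<rho>) (boundary_kernel (t + u)) \<le> 2 * u powr (- (1/2 - q/4))"
      using \<mu>'(2)
    proof eventually_elim
      case (elim u)
      have "L2_norm (weighted \<rho>) (boundary_kernel (t + u)) \<le> 2 * (t + u) powr (q/4 - 1/2)"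
        using elim t by (intro L2(2)) auto
      also have "\<dots> \<le> 2 * u powr (q/4 - 1/2)"
        using elim t exponent_bounds by (intro mult_left_mono powr_mono2') auto
      finally show ?case by simp
    qed
  qed
qed

lemma boundary_average_L2:
  assumes "admissible (1/2 - q/4) \<mu>" "0 \<le> t"
  shows "(\<lambda>x. LINT u|\<mu>. boundary_kernel (t + u) x) \<in> L2 (weighted \<rho>)"
  by (rule L2_kernel_average.average_L2[OF kernel_average[OF assms]])

lemma inner_boundary_average:
  assumes "admissible (1/2 - q/4) \<mu>" "0 \<le> t" "v \<in> L2 (weighted \<rho>)"
  shows "integrable \<mu> (\<lambda>u. L2_inner (weighted \<rho>) (boundary_kernel (t + u)) v)"
    and "L2_inner (weighted \<rho>) (\<lambda>x. LINT u|\<mu>. boundary_kernel (t + u) x) v =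
      (LINT u|\<mu>. L2_inner (weighted \<rho>) (boundary_kernel (t + u)) v)"
  using L2_kernel_average.inner_integrable[OF kernel_average[OF assms(1,2)] assms(3)]
    L2_kernel_average.inner_average[OF kernel_average[OF assms(1,2)] assms(3)] by auto

lemma AE_weighted_pos: "AE x in weighted \<rho>. 0 < x"
  by (rule AE_I2) simp

end

lemma half_line_boundary_weight: "boundary_weight (\<lambda>_. 1) (-1)"
  by unfold_locales auto

lemma boundary_average_L2_half_line:
  assumes "admissible (3/4) \<mu>"
  shows "(\<lambda>x. LINT u|\<mu>. boundary_kernel u x) \<in> L2 half_line"
  using boundary_weight.boundary_average_L2[OF half_line_boundary_weight, of \<mu> 0] assms
  by (simp add: weighted_one)

context boundary_weight
begin

text \<open>
  If the average also belongs to the unweighted space, then the extended semigroup acts on it through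
  the heat kernel, which shifts the time in every boundary kernel.
\<close>

lemma extension_square_integrable_boundary_average:
  assumes S: "dirichlet_heat_extension \<rho> S" and t: "0 < t"
    and \<mu>: "admissible (1/2 - q/4) \<mu>" "admissible (3/4) \<mu>" and v: "v \<in> L2 (weighted \<rho>)"
  shows "L2_inner (weighted \<rho>) (S t (\<lambda>x. LINT u|\<mu>. boundary_kernel u x)) v =
    (LINT u|\<mu>. L2_inner (weighted \<rho>) (boundary_kernel (t + u)) v)"
proof -
  let ?g = "\<lambda>x. LINT u|\<mu>. boundary_kernel u x"
  let ?h = "\<lambda>x. LINT u|\<mu>. boundary_kernel (t + u) x"
  have C0: "C0_semigroup (weighted \<rho>) S" using S by (simp add: dirichlet_heat_extension_def)
  have g: "?g \<in> L2 (weighted \<rho>)" using boundary_average_L2[OF \<mu>(1), of 0] by simp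
  have h: "?h \<in> L2 (weighted \<rho>)" using boundary_average_L2[OF \<mu>(1), of t] t by simp
  have "AE x in weighted \<rho>. S t ?g x = dirichlet_heat t ?g x"
    using S t g boundary_average_L2_half_line[OF \<mu>(2)] by (simp add: dirichlet_heat_extension_def)
  then have "AE x in weighted \<rho>. S t ?g x = ?h x"
    using AE_weighted_pos by eventually_elim (use dirichlet_heat_boundary_average[OF \<mu>(1) t] in simp)
  then have "L2_inner (weighted \<rho>) (S t ?g) v = L2_inner (weighted \<rho>) ?h v"
    using t by (intro L2_inner_cong_AE L2_semigroup_in[OF C0] g h v) auto
  then show ?thesis using inner_boundary_average(2)[OF \<mu>(1) _ v, of t] t by simp
qed

text \<open>
  The averages of interest need not be square-integrable near the boundary without the weight. Restricting
  \<open>\<mu>\<close> to \<open>{1 / Suc n<..}\<close> removes that obstacle, and the restricted averages converge in the weighted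
  space, where the extended semigroup is bounded.
\<close>

lemma extension_boundary_average:
  assumes S: "dirichlet_heat_extension \<rho> S" and t: "0 < t"
    and \<mu>: "admissible (1/2 - q/4) \<mu>" and v: "v \<in> L2 (weighted \<rho>)"
  shows "L2_inner (weighted \<rho>) (S t (\<lambda>x. LINT u|\<mu>. boundary_kernel u x)) v =
    (LINT u|\<mu>. L2_inner (weighted \<rho>) (boundary_kernel (t + u)) v)"
proof -
  let ?H = "weighted \<rho>" and ?\<gamma> = "1/2 - q/4"
  define g where "g \<nu> = (\<lambda>x. LINT u|\<nu>. boundary_kernel u x)" for \<nu>
  define far near where "far n = density \<mu> (indicator {1 / Suc n<..})"
    and "near n = density \<mu> (indicator {..1 / Suc n})" for n
  have \<mu>': "finite_measure \<mu>" "AE u in \<mu>. 0 < u" "integrable \<mu> (\<lambda>u. u powr (- ?\<gamma>))"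
    and [measurable_cong]: "sets \<mu> = sets borel"
    using \<mu> by (auto simp: admissible_def)
  have C0: "C0_semigroup ?H S" and bdd: "bounded_semigroup ?H S"
    using S by (simp_all add: dirichlet_heat_extension_def)
  obtain K where K0: "0 \<le> K" and K: "\<And>t f. 0 \<le> t \<Longrightarrow> f \<in> L2 ?H \<Longrightarrow> L2_norm ?H (S t f) \<le> K * L2_norm ?H f"
    using bounded_semigroup_bound[OF bdd] by blast
  have far: "admissible ?\<gamma> (far n)" and near: "admissible ?\<gamma> (near n)" for n
    unfolding far_def near_def by (rule admissible_density_indicator[OF \<mu>, where C=1]; simp)+
  have far': "admissible (3/4) (far n)" for n
    unfolding far_def
  proof (rule admissible_density_indicator[OF \<mu>])
    fix u :: real
    assume "u \<in> {1 / Suc n<..}" "0 < u"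
    then have "(1 / Suc n) powr (?\<gamma> - 3/4) \<ge> u powr (?\<gamma> - 3/4)"
      using exponent_bounds by (intro powr_mono2') auto
    then have "u powr (?\<gamma> - 3/4) * u powr (- ?\<gamma>) \<le> (1 / Suc n) powr (?\<gamma> - 3/4) * u powr (- ?\<gamma>)"
      by (rule mult_right_mono) simp
    then show "u powr (- (3/4)) \<le> (1 / Suc n) powr (?\<gamma> - 3/4) * u powr (- ?\<gamma>)"
      unfolding powr_add[symmetric] by simp
  qed simp
  have gL2: "g \<nu> \<in> L2 ?H" if "admissible ?\<gamma> \<nu>" for \<nu>
    unfolding g_def using boundary_average_L2[OF that, of 0] by simp
  have integral_density_indicator: "(LINT u|density \<mu> (indicator A). h u) = (LINT u|\<mu>. indicator A u * h u)"
    if [measurable]: "A \<in> sets borel" "h \<in> borel_measurable \<mu>" for A and h :: "real \<Rightarrow> real"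
    using integral_density[of h \<mu> "indicator A"] by (simp add: ennreal_indicator)
  have split: "AE x in ?H. g \<mu> x = g (far n) x + g (near n) x" for n
    using AE_weighted_pos
  proof eventually_elim
    case (elim x)
    have int: "integrable \<mu> (\<lambda>u. indicator A u * boundary_kernel u x)" if [measurable]: "A \<in> sets borel" for A
      using integrable_real_mult_indicator[OF _ boundary_kernel_integrable[OF \<mu> _ elim, of 0], of A]
        \<open>sets \<mu> = sets borel\<close> by (simp add: mult.commute)
    have "g \<mu> x = (LINT u|\<mu>. indicator {1 / Suc n<..} u * boundary_kernel u x + indicator {..1 / Suc n} u * boundary_kernel u x)"
      unfolding g_def by (intro Bochner_Integration.integral_cong) (auto simp: indicator_def)
    also have "\<dots> = g (far n) x + g (near n) x"
      unfolding g_def far_def near_def by (subst Bochner_Integration.integral_add) (simp_all add: int integral_density_indicator)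
    finally show ?case .
  qed
  \<comment> \<open>Linearity and boundedness are applied to the difference of the two averages, since \<open>S t\<close> respects equality almost everywhere only through them.\<close>
  have error: "\<bar>L2_inner ?H (S t (g \<mu>)) v - L2_inner ?H (S t (g (far n))) v\<bar> \<le>
      K * L2_norm ?H (g (near n)) * L2_norm ?H v" for n
  proof -
    define d where "d = (\<lambda>x. 1 * g \<mu> x + (- 1) * g (far n) x)"
    have d: "d \<in> L2 ?H" unfolding d_def by (intro L2_lincomb gL2 \<mu> far)
    have "L2_inner ?H (S t d) v = 1 * L2_inner ?H (S t (g \<mu>)) v + (- 1) * L2_inner ?H (S t (g (far n))) v"
      unfolding d_def using t by (intro semigroup_inner_lincomb[OF C0] gL2 \<mu> far v) simp
    then have "\<bar>L2_inner ?H (S t (g \<mu>)) v - L2_inner ?H (S t (g (far n))) v\<bar> = \<bar>L2_inner ?H (S t d) v\<bar>"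
      by simp
    also have "\<dots> \<le> L2_norm ?H (S t d) * L2_norm ?H v"
      using t by (intro L2_Cauchy_Schwarz L2_semigroup_in[OF C0] d v) simp
    also have "\<dots> \<le> K * L2_norm ?H d * L2_norm ?H v"
      using t by (intro mult_right_mono K d) auto
    also have "L2_norm ?H d = L2_norm ?H (g (near n))"
      using split[of n] by (intro L2_norm_cong_AE d gL2 near) (auto simp: d_def elim!: eventually_mono)
    finally show ?thesis .
  qed
  have inverse_Suc_less: "\<forall>\<^sub>F n in sequentially. 1 / Suc n < u" if "0 < u" for u :: real
    using order_tendstoD(2)[OF LIMSEQ_inverse_real_of_nat that] by (simp add: inverse_eq_divide)
  have near_to_0: "(\<lambda>n. LINT u|near n. 2 * u powr (- ?\<gamma>)) \<longlonglongrightarrow> 0"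
  proof -
    have "(\<lambda>n. LINT u|\<mu>. indicator {..1 / Suc n} u * (2 * u powr (- ?\<gamma>))) \<longlonglongrightarrow> (LINT u|\<mu>. 0)"
    proof (rule integral_dominated_convergence)
      show "integrable \<mu> (\<lambda>u. 2 * u powr (- ?\<gamma>))" using \<mu>'(3) by simp
      show "AE u in \<mu>. (\<lambda>n. indicator {..1 / Suc n} u * (2 * u powr (- ?\<gamma>))) \<longlonglongrightarrow> 0"
        using \<mu>'(2)
      proof eventually_elim
        case (elim u)
        show ?case
          by (rule tendsto_eventually, rule eventually_mono[OF inverse_Suc_less[OF elim]])
             (auto simp: indicator_def)
      qed
    qed (auto simp: indicator_def)
    then show ?thesis
      unfolding near_def by (subst integral_density_indicator) simp_all
  qed
  let ?h = "\<lambda>u. L2_inner ?H (boundary_kernel (t + u)) v"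
  have h: "integrable \<mu> ?h" using inner_boundary_average(1)[OF \<mu> _ v, of t] t by simp
  then have [measurable]: "?h \<in> borel_measurable \<mu>" by simp
  have far_to: "(\<lambda>n. L2_inner ?H (S t (g (far n))) v) \<longlonglongrightarrow> (LINT u|\<mu>. ?h u)"
  proof -
    have "(\<lambda>n. LINT u|\<mu>. indicator {1 / Suc n<..} u * ?h u) \<longlonglongrightarrow> (LINT u|\<mu>. ?h u)"
    proof (rule integral_dominated_convergence)
      show "integrable \<mu> (\<lambda>u. \<bar>?h u\<bar>)" using h by simp
      show "AE u in \<mu>. (\<lambda>n. indicator {1 / Suc n<..} u * ?h u) \<longlonglongrightarrow> ?h u"
        using \<mu>'(2)
      proof eventually_elim
        case (elim u)
        show ?case
          by (rule tendsto_eventually, rule eventually_mono[OF inverse_Suc_less[OF elim]])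
             (auto simp: indicator_def)
      qed
    qed (auto simp: indicator_def)
    also have "(\<lambda>n. LINT u|\<mu>. indicator {1 / Suc n<..} u * ?h u) = (\<lambda>n. LINT u|far n. ?h u)"
      unfolding far_def by (intro ext integral_density_indicator[symmetric]) measurable
    also have "\<dots> = (\<lambda>n. L2_inner ?H (S t (g (far n))) v)"
      unfolding g_def using extension_square_integrable_boundary_average[OF S t far far' v] by simp
    finally show ?thesis .
  qed
  have "(\<lambda>n. L2_inner ?H (S t (g (far n))) v - L2_inner ?H (S t (g \<mu>)) v) \<longlonglongrightarrow> 0"
  proof (rule Lim_null_comparison)
    have "(\<lambda>n. K * (LINT u|near n. 2 * u powr (- ?\<gamma>)) * L2_norm ?H v) \<longlonglongrightarrow> K * 0 * L2_norm ?H v"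
      by (intro tendsto_intros near_to_0)
    then show "(\<lambda>n. K * (LINT u|near n. 2 * u powr (- ?\<gamma>)) * L2_norm ?H v) \<longlonglongrightarrow> 0" by simp
    show "\<forall>\<^sub>F n in sequentially. norm (L2_inner ?H (S t (g (far n))) v - L2_inner ?H (S t (g \<mu>)) v) \<le>
        K * (LINT u|near n. 2 * u powr (- ?\<gamma>)) * L2_norm ?H v"
    proof (intro always_eventually allI)
      fix n
      have "L2_norm ?H (g (near n)) \<le> (LINT u|near n. 2 * u powr (- ?\<gamma>))"
        using L2_kernel_average.average_norm_le[OF kernel_average[OF near, of 0]] by (simp add: g_def)
      then have "K * L2_norm ?H (g (near n)) * L2_norm ?H v \<le> K * (LINT u|near n. 2 * u powr (- ?\<gamma>)) * L2_norm ?H v"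
        using K0 by (intro mult_right_mono mult_left_mono) auto
      then show "norm (L2_inner ?H (S t (g (far n))) v - L2_inner ?H (S t (g \<mu>)) v) \<le>
          K * (LINT u|near n. 2 * u powr (- ?\<gamma>)) * L2_norm ?H v"
        using error[of n] by (simp add: abs_minus_commute)
    qed
  qed
  then have "(\<lambda>n. L2_inner ?H (S t (g (far n))) v) \<longlonglongrightarrow> L2_inner ?H (S t (g \<mu>)) v"
    by (simp add: LIM_zero_iff)
  from LIMSEQ_unique[OF this far_to] show ?thesis by (simp add: g_def)
qed

end

context boundary_weight
begin

text \<open>
  On averages of boundary kernels \<open>S t\<close> adds \<open>t\<close> to the time, so that averaging over \<open>t\<close> convolves the
  measures. The left-hand side is the negative fractional power of \<open>r - A\<close>, tested against \<open>v\<close>.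
\<close>

lemma gamma_average_boundary_average:
  assumes S: "dirichlet_heat_extension \<rho> S" and a: "0 < a" and r: "0 < r"
    and \<mu>: "admissible (1/2 - q/4) \<mu>" and v: "v \<in> L2 (weighted \<rho>)"
  shows "(LINT t|gamma_measure a r. L2_inner (weighted \<rho>) (S \<bar>t\<bar> (\<lambda>x. LINT u|\<mu>. boundary_kernel u x)) v) =
    L2_inner (weighted \<rho>) (\<lambda>x. LINT z|(gamma_measure a r \<star> \<mu>). boundary_kernel z x) v"
proof -
  let ?H = "weighted \<rho>" and ?g = "\<lambda>x. LINT u|\<mu>. boundary_kernel u x"
  have C0: "C0_semigroup ?H S" and bdd: "bounded_semigroup ?H S"
    using S by (simp_all add: dirichlet_heat_extension_def)
  have \<mu>': "finite_measure \<mu>" "sets \<mu> = sets borel" using \<mu> by (auto simp: admissible_def)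
  have conv: "admissible (1/2 - q/4) (gamma_measure a r \<star> \<mu>)"
    using exponent_bounds by (intro admissible_convolution \<mu> finite_gamma_measure a r AE_gamma_measure_pos) auto
  have int: "integrable (gamma_measure a r \<star> \<mu>) (\<lambda>z. L2_inner ?H (boundary_kernel z) v)"
    using inner_boundary_average(1)[OF conv _ v, of 0] by simp
  have [measurable]: "(\<lambda>z. L2_inner ?H (boundary_kernel z) v) \<in> borel_measurable borel"
    using borel_measurable_integrable[OF int] by simp
  interpret \<mu>: finite_measure \<mu> by fact
  have [measurable_cong]: "sets \<mu> = sets borel" by fact
  have g: "?g \<in> L2 ?H" using boundary_average_L2[OF \<mu>, of 0] by simp
  have "(LINT t|gamma_measure a r. L2_inner ?H (S \<bar>t\<bar> ?g) v) =
      (LINT t|gamma_measure a r. LINT u|\<mu>. L2_inner ?H (boundary_kernel (t + u)) v)"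
  proof (rule integral_cong_AE)
    show "AE t in gamma_measure a r. L2_inner ?H (S \<bar>t\<bar> ?g) v = (LINT u|\<mu>. L2_inner ?H (boundary_kernel (t + u)) v)"
      using AE_gamma_measure_pos by eventually_elim (simp add: extension_boundary_average[OF S _ \<mu> v])
    show "(\<lambda>t. L2_inner ?H (S \<bar>t\<bar> ?g) v) \<in> borel_measurable (gamma_measure a r)"
      using semigroup_inner_measurable[OF C0 bdd g v] by simp
  qed measurable
  also have "\<dots> = (LINT z|(gamma_measure a r \<star> \<mu>). L2_inner ?H (boundary_kernel z) v)"
    by (rule integral_convolution[OF finite_gamma_measure[OF a r] \<mu>'(1) sets_gamma_measure \<mu>'(2) int, symmetric])
  also have "\<dots> = L2_inner ?H (\<lambda>x. LINT z|(gamma_measure a r \<star> \<mu>). boundary_kernel z x) v"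
    using inner_boundary_average(2)[OF conv _ v, of 0] by simp
  finally show ?thesis .
qed

section \<open>The Dirichlet map and fractional domains\<close>

lemma psi_L2:
  assumes l: "0 < l"
  shows "psi l \<in> L2 (weighted \<rho>)"
proof (rule L2_cong_AE)
  have "admissible (1/2 - q/4) (gamma_measure 1 l)"
    using exponent_bounds l by (intro admissible_gamma_measure) auto
  from boundary_average_L2[OF this, of 0]
  show "(\<lambda>x. LINT u|gamma_measure 1 l. boundary_kernel u x) \<in> L2 (weighted \<rho>)" by simp
  show "psi l \<in> borel_measurable (weighted \<rho>)"
    unfolding psi_def[abs_def] by (rule weighted_measurable) measurable
  show "AE x in weighted \<rho>. (LINT u|gamma_measure 1 l. boundary_kernel u x) = psi l x"
    using AE_weighted_pos by eventually_elim (rule psi_eq_boundary_average[OF l])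
qed

text \<open>
  The image of \<open>psi l\<close> under the power \<open>a\<close> of \<open>r - A\<close>. It comes from the splitting of \<open>psi l\<close> into
  \<open>psi r\<close> and \<open>r - l\<close> times the resolvent at \<open>r\<close> applied to \<open>psi l\<close>: these are averages over
  \<open>gamma_measure 1 r\<close> and over its convolution with \<open>gamma_measure 1 l\<close>, and in both of them the
  factor \<open>gamma_measure a r\<close> is removed.
\<close>

definition psi_preimage :: "real \<Rightarrow> real \<Rightarrow> real \<Rightarrow> real \<Rightarrow> real" where
  "psi_preimage r l a x = (LINT u|gamma_measure (1 - a) r. boundary_kernel u x) +
     (r - l) * (LINT u|(gamma_measure (1 - a) r \<star> gamma_measure 1 l). boundary_kernel u x)"

text \<open>
  The upper bound on \<open>a\<close> says that \<open>gamma_measure (1 - a) r\<close>, with density of order \<open>u powr (- a)\<close>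
  near \<open>0\<close>, integrates the blow-up rate \<open>u powr (q/4 - 1/2)\<close> of the boundary kernel.
\<close>

lemma psi_preimage_frac_power:
  assumes S: "dirichlet_heat_extension \<rho> S" and a: "0 < a" "a < 1/2 + q/4" and r: "0 < r" and l: "0 < l"
  shows "psi_preimage r l a \<in> L2 (weighted \<rho>)"
    and "(\<lambda>x. c * psi l x, \<lambda>x. c * psi_preimage r l a x) \<in>
      frac_power (weighted \<rho>) (shifted r (generator (weighted \<rho>) S)) a"
proof -
  let ?H = "weighted \<rho>" and ?\<gamma> = "1/2 - q/4"
  have C0: "C0_semigroup ?H S" and bdd: "bounded_semigroup ?H S"
    using S by (simp_all add: dirichlet_heat_extension_def)
  define \<mu>1 where "\<mu>1 = gamma_measure (1 - a) r"
  define \<mu>2 where "\<mu>2 = (\<mu>1 \<star> gamma_measure 1 l)"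
  define g where "g \<mu> = (\<lambda>x. LINT u|\<mu>. boundary_kernel u x)" for \<mu>
  have a1: "a < 1" using a exponent_bounds by simp
  have El: "admissible ?\<gamma> (gamma_measure 1 l)" and Er: "admissible ?\<gamma> (gamma_measure 1 r)"
    using exponent_bounds l r by (auto intro!: admissible_gamma_measure)
  have \<mu>1: "admissible ?\<gamma> \<mu>1"
    unfolding \<mu>1_def using a a1 r by (intro admissible_gamma_measure) auto
  have fin1: "finite_measure \<mu>1" unfolding \<mu>1_def using a1 r by (intro finite_gamma_measure) auto
  have pos1: "AE t in \<mu>1. 0 < t" unfolding \<mu>1_def by (rule AE_gamma_measure_pos)
  have \<mu>2: "admissible ?\<gamma> \<mu>2"
    unfolding \<mu>2_def using exponent_bounds
    by (intro admissible_convolution El fin1 pos1) (simp_all add: \<mu>1_def)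
  have gL2: "g \<mu> \<in> L2 ?H" if "admissible ?\<gamma> \<mu>" for \<mu>
    unfolding g_def using boundary_average_L2[OF that, of 0] by simp
  have pre: "psi_preimage r l a = (\<lambda>x. 1 * g \<mu>1 x + (r - l) * g \<mu>2 x)"
    by (simp add: psi_preimage_def fun_eq_iff g_def \<mu>1_def \<mu>2_def)
  show L2: "psi_preimage r l a \<in> L2 ?H"
    unfolding pre by (intro L2_lincomb gL2 \<mu>1 \<mu>2)
  have conv1: "(gamma_measure a r \<star> \<mu>1) = (gamma_measure 1 r)"
    unfolding \<mu>1_def using gamma_measure_convolution[of a "1 - a" r] a(1) a1 r by simp
  have conv2: "(gamma_measure a r \<star> \<mu>2) = (gamma_measure 1 r \<star> gamma_measure 1 l)"
    unfolding \<mu>2_def conv1[symmetric] using a(1) r l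
    by (intro convolution_associative fin1 finite_gamma_measure) (auto simp: \<mu>1_def)
  have conv2_adm: "admissible ?\<gamma> (gamma_measure 1 r \<star> gamma_measure 1 l)"
    using exponent_bounds r by (intro admissible_convolution El finite_gamma_measure AE_gamma_measure_pos) auto
  show "(\<lambda>x. c * psi l x, \<lambda>x. c * psi_preimage r l a x) \<in>
      frac_power ?H (shifted r (generator ?H S)) a"
  proof (rule frac_power_memI[OF C0 bdd a(1) r])
    show "(\<lambda>x. c * psi l x) \<in> L2 ?H" by (intro L2_scale psi_L2 l)
    show "(\<lambda>x. c * psi_preimage r l a x) \<in> L2 ?H" by (intro L2_scale L2)
    fix v
    assume v: "v \<in> L2 ?H"
    let ?I = "\<lambda>\<mu> t. L2_inner ?H (S \<bar>t\<bar> (g \<mu>)) v"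
    have int: "integrable (gamma_measure a r) (?I \<mu>)" if "admissible ?\<gamma> \<mu>" for \<mu>
      by (rule semigroup_inner_integrable[OF C0 bdd a(1) r gL2[OF that] v])
    have lin: "L2_inner ?H (S \<bar>t\<bar> (\<lambda>x. c * psi_preimage r l a x)) v = c * ?I \<mu>1 t + (c * (r - l)) * ?I \<mu>2 t" for t
    proof -
      have "(\<lambda>x. c * psi_preimage r l a x) = (\<lambda>x. c * g \<mu>1 x + (c * (r - l)) * g \<mu>2 x)"
        by (simp add: pre algebra_simps)
      then show ?thesis using semigroup_inner_lincomb[OF C0 abs_ge_zero gL2[OF \<mu>1] gL2[OF \<mu>2] v] by simp
    qed
    have "(LINT t|gamma_measure a r. L2_inner ?H (S \<bar>t\<bar> (\<lambda>x. c * psi_preimage r l a x)) v) =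
        c * (LINT t|gamma_measure a r. ?I \<mu>1 t) + (c * (r - l)) * (LINT t|gamma_measure a r. ?I \<mu>2 t)"
      unfolding lin using int[OF \<mu>1] int[OF \<mu>2] by simp
    also have "\<dots> = c * L2_inner ?H (g (gamma_measure 1 r)) v +
        (c * (r - l)) * L2_inner ?H (g (gamma_measure 1 r \<star> gamma_measure 1 l)) v"
      using gamma_average_boundary_average[OF S a(1) r \<mu>1 v] gamma_average_boundary_average[OF S a(1) r \<mu>2 v]
      by (simp only: g_def conv1 conv2)
    also have "\<dots> = L2_inner ?H (\<lambda>x. c * g (gamma_measure 1 r) x + (c * (r - l)) * g (gamma_measure 1 r \<star> gamma_measure 1 l) x) v"
      by (intro L2_inner_lincomb[symmetric] gL2 Er conv2_adm v)
    also have "\<dots> = L2_inner ?H (\<lambda>x. c * psi l x) v"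
    proof (intro L2_inner_cong_AE L2_lincomb L2_scale psi_L2 gL2 Er conv2_adm v l)
      show "AE x in ?H. c * g (gamma_measure 1 r) x + (c * (r - l)) * g (gamma_measure 1 r \<star> gamma_measure 1 l) x = c * psi l x"
        using AE_weighted_pos
      proof eventually_elim
        case (elim x)
        show ?case
        proof (cases "r = l")
          case True
          then show ?thesis using elim l by (simp add: g_def psi_eq_boundary_average)
        next
          case False
          then show ?thesis
            using elim l r psi_difference_eq_boundary_average[OF r l False elim]
            by (simp add: g_def psi_eq_boundary_average) (simp add: algebra_simps)
        qed
      qed
    qed simp
    finally show "(LINT t|gamma_measure a r. L2_inner ?H (S \<bar>t\<bar> (\<lambda>x. c * psi_preimage r l a x)) v) =
        L2_inner ?H (\<lambda>x. c * psi l x) v" .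
  qed
qed

lemma psi_Domain_frac_power:
  assumes S: "dirichlet_heat_extension \<rho> S" and a: "0 \<le> a" "a < 1/2 + q/4" and r: "0 < r" and l: "0 < l"
  obtains g where "g \<in> L2 (weighted \<rho>)"
    "\<And>c. (\<lambda>x. c * psi l x, \<lambda>x. c * g x) \<in> frac_power (weighted \<rho>) (shifted r (generator (weighted \<rho>) S)) a"
proof (cases "a = 0")
  case True
  show thesis
    by (rule that[of "psi l"]) (auto simp: True frac_power_def intro: L2_scale psi_L2[OF l])
next
  case False
  then have "0 < a" using a by simp
  from psi_preimage_frac_power[OF S this a(2) r l] show thesis by (rule that)
qed

lemma dirichlet_map_bounded_linear:
  assumes S: "dirichlet_heat_extension \<rho> S" and a: "0 \<le> a" "a < 1/2 + q/4" and l: "0 < l"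
  shows "bounded_linear_into_dom (weighted \<rho>)
    (frac_power (weighted \<rho>) (shifted l (generator (weighted \<rho>) S)) a) (dirichlet_map l)"
proof -
  let ?H = "weighted \<rho>" and ?B = "frac_power (weighted \<rho>) (shifted l (generator (weighted \<rho>) S)) a"
  obtain g where g: "\<And>c. (\<lambda>x. c * psi l x, \<lambda>x. c * g x) \<in> ?B"
    using psi_Domain_frac_power[OF S a l l] by blast
  have "graph_norm ?H ?B (dirichlet_map l c) \<le> (L2_norm ?H (psi l) + L2_norm ?H g) * \<bar>c\<bar>" for c
  proof -
    have "graph_norm ?H ?B (dirichlet_map l c) \<le> L2_norm ?H (dirichlet_map l c) + L2_norm ?H (\<lambda>x. c * g x)"
      unfolding graph_norm_def
    proof (rule cINF_lower)
      show "bdd_below ((\<lambda>g. L2_norm ?H (dirichlet_map l c) + L2_norm ?H g) ` {g. (dirichlet_map l c, g) \<in> ?B})"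
        by (intro bdd_belowI2[where m=0]) simp
    qed (use g[of c] in \<open>simp add: dirichlet_map_def\<close>)
    also have "\<dots> = (L2_norm ?H (psi l) + L2_norm ?H g) * \<bar>c\<bar>"
      unfolding dirichlet_map_def L2_norm_scale by (simp add: algebra_simps)
    finally show ?thesis .
  qed
  then show ?thesis
    unfolding bounded_linear_into_dom_def
  proof (intro conjI allI exI[of _ "L2_norm ?H (psi l) + L2_norm ?H g"])
    show "dirichlet_map l c \<in> Domain ?B" for c
      using g[of c] unfolding dirichlet_map_def by (rule DomainI)
    show "AE x in ?H. dirichlet_map l (c * a + d * b) x = c * dirichlet_map l a x + d * dirichlet_map l b x"
      for a b c d by (simp add: dirichlet_map_def algebra_simps)
  qed
qed

end

theorem lemma2p2:
  fixes \<theta> l r :: real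
    and \<rho> :: "real \<Rightarrow> real"
    and S :: "real \<Rightarrow> (real \<Rightarrow> real) \<Rightarrow> (real \<Rightarrow> real)"
    and A :: "real operator"
  assumes "0 < \<theta>" and "\<theta> < 1"
    and "\<rho> = (\<lambda>\<xi>. \<xi> powr (1 + \<theta>)) \<or> \<rho> = (\<lambda>\<xi>. min 1 (\<xi> powr (1 + \<theta>)))"
    and "dirichlet_heat_extension \<rho> S"
    and "A = generator (weighted \<rho>) S"
    and "l > 0" and "r > 0"
  shows "(\<forall>\<alpha>\<in>{0..<1/2 + \<theta>/4}. psi l \<in> Domain (frac_power (weighted \<rho>) (shifted r A) \<alpha>)) \<and>
         (\<forall>\<alpha>\<in>{0..<1/2 + \<theta>/4}.
            bounded_linear_into_dom (weighted \<rho>)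
              (frac_power (weighted \<rho>) (shifted l A) \<alpha>) (dirichlet_map l))"
proof -
  interpret boundary_weight \<rho> \<theta>
  proof
    show "\<rho> \<in> borel_measurable borel"
      using assms(3) by auto
    show "0 \<le> \<rho> x \<and> \<rho> x \<le> x powr (1 + \<theta>)" for x
      using assms(3) by auto
  qed (use assms(1,2) in auto)
  have "psi l \<in> Domain (frac_power (weighted \<rho>) (shifted r A) \<alpha>)" if \<alpha>: "\<alpha> \<in> {0..<1/2 + \<theta>/4}" for \<alpha>
  proof -
    obtain g where "\<And>c. (\<lambda>x. c * psi l x, \<lambda>x. c * g x) \<in> frac_power (weighted \<rho>) (shifted r A) \<alpha>"
      using psi_Domain_frac_power[OF assms(4), of \<alpha> r l] \<alpha> assms(5-7) by auto
    from this[of 1] show ?thesis by (auto simp: Domain.simps)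
  qed
  moreover have "bounded_linear_into_dom (weighted \<rho>)
      (frac_power (weighted \<rho>) (shifted l A) \<alpha>) (dirichlet_map l)" if "\<alpha> \<in> {0..<1/2 + \<theta>/4}" for \<alpha>
    using dirichlet_map_bounded_linear[OF assms(4), of \<alpha> l] that assms(5,6) by simp
  ultimately show ?thesis by blast
qed

end
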